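(* Let $d\ge2$ be an integer, $\beta\ge\frac{1}{2\log2}$, and let $\mathcal{X}=\{x_k\}_{k=1}^s\subseteq[-\frac12,\frac12)^d$ be a set of $s$ distinct points. Suppose $m\ge4s$ (real) and there is $0<\tau\le\frac{1}{4d}$ such that $\frac{2\beta d\nu}{\tau}\le m$, where $\nu:=\nu_\infty(\tau,\mathcal{X})$. Then $$\sigma_{\min}(\mathcal{F}_{Q_m,\mathcal{X}})\ge\sqrt{\frac2s}\,\Big(1-\frac12e^{1/(2\beta)}\Big)^{\nu/2}\sqrt{|Q_{m/(2\nu)}|}\ \min_{1\le k\le s}\Bigg\{\prod_{0<|x_j-x_k|_1\le\frac{\nu}{m}}\frac{m}{\nu}|x_j-x_k|_1\Bigg\},$$ $$\sigma_{\min}(\Phi_{Q_m,\mathcal{X}})\ge\sqrt{\frac2s}\,\Big(1-\frac12e^{1/(2\beta)}\Big)^{\nu/2}\sqrt{|Q_{m/(2\nu)}|_*}\ \min_{1\le k\le s}\Bigg\{\prod_{0<|x_j-x_k|_1\le\frac{\nu}{m}}\frac{m}{\nu}|x_j-x_k|_1\Bigg\},$$ where the products run over indices $j$ satisfying the displayed condition (an empty product equals $1$).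
   Context: $Q_m=\{x\in\mathbb{R}^d:|x|_\infty\le m\}$. For compact $\Omega\subset\mathbb{R}^d$, $|\Omega|$ is its Lebesgue measure and $|\Omega|_*=|\Omega\cap\mathbb{Z}^d|$ is the number of integer points in $\Omega$. $\mathcal{F}_{\Omega,\mathcal{X}}:\mathbb{C}^s\to L^2(\Omega)$ is $(\mathcal{F}_{\Omega,\mathcal{X}}u)(\omega)=\sum_{k=1}^s u_ke^{-2\pi i\omega\cdot x_k}$, and $\Phi_{\Omega,\mathcal{X}}=[e^{-2\pi i\omega\cdot x}]_{\omega\in\Omega\cap\mathbb{Z}^d,\,x\in\mathcal{X}}$. $\sigma_{\min}$ denotes the minimum of $\|\mathcal{F}_{\Omega,\mathcal{X}}u\|_{L^2(\Omega)}$ (respectively $|\Phi_{\Omega,\mathcal{X}}u|_2$) over $u\in\mathbb{C}^s$ with $|u|_2=1$. Local sparsity: $\nu_p(\tau,\mathcal{X})=\max_{x\in\mathcal{X}}|\mathcal{N}_p(x,\tau,\mathcal{X})|$, where $\mathcal{N}_p(x,\tau,\mathcal{X})=\{x'\in\mathcal{X}:|x'-x|_p\le\tau\}$. Convention on metrics: in statements about $\mathcal{F}_{\Omega,\mathcal{X}}$, $|\cdot|_p$ is the usual $\ell^p$ norm on $\mathbb{R}^d$; in statements about $\Phi_{\Omega,\mathcal{X}}$, $\mathcal{X}$ is regarded as a subset of the torus $\mathbb{T}^d=(\mathbb{R}/\mathbb{Z})^d\cong[-\frac12,\frac12)^d$ and $|x|_p$ means $\min_{n\in\mathbb{Z}^d}|x+n|_p$.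 Hypotheses (including $\nu$) and conclusion are read in the metric corresponding to the operator. *)

theory Defs
  imports "HOL-Analysis.Analysis"
begin

text \<open>The dimension is \<open>d = CARD('d)\<close>. The point set is a family \<open>x :: 's \<Rightarrow> real ^ 'd\<close>, injective where
  distinctness is required, over a finite index type with \<open>s = CARD('s)\<close>; coefficient vectors
  \<open>u \<in> \<complex>\<^sup>s\<close> have type \<open>complex ^ 's\<close>, whose \<open>norm\<close> is the Euclidean one. The sup norm is the library's
  \<open>infnorm\<close>.\<close>

definition l1norm :: "real ^ 'd \<Rightarrow> real" where
  "l1norm x = (\<Sum>i\<in>UNIV. \<bar>x $ i\<bar>)"

definition int_vecs :: "(real ^ 'd) set" where
  "int_vecs = {n. \<forall>i. n $ i \<in> \<int>}"

text \<open>The torus version of a norm \<open>N\<close>. The infimum is a minimum for \<open>N = infnorm\<close> and \<open>N = l1norm\<close>,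
  see \<open>torus_norm_attained\<close> below.\<close>

definition torus_norm :: "(real ^ 'd \<Rightarrow> real) \<Rightarrow> real ^ 'd \<Rightarrow> real" where
  "torus_norm N x = (INF n\<in>int_vecs. N (x + n))"

definition nbhd :: "(real ^ 'd \<Rightarrow> real) \<Rightarrow> real ^ 'd \<Rightarrow> real \<Rightarrow> (real ^ 'd) set \<Rightarrow> (real ^ 'd) set" where
  "nbhd N x \<tau> X = {x' \<in> X. N (x' - x) \<le> \<tau>}"

definition local_sparsity :: "(real ^ 'd \<Rightarrow> real) \<Rightarrow> real \<Rightarrow> (real ^ 'd) set \<Rightarrow> nat" where
  "local_sparsity N \<tau> X = Max ((\<lambda>x. card (nbhd N x \<tau> X)) ` X)"

definition Qcube :: "real \<Rightarrow> (real ^ 'd) set" where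
  "Qcube m = {x. infnorm x \<le> m}"

definition fourier_map :: "('s::finite \<Rightarrow> real ^ 'd) \<Rightarrow> complex ^ 's \<Rightarrow> real ^ 'd \<Rightarrow> complex" where
  "fourier_map x u \<omega> = (\<Sum>k\<in>UNIV. u $ k * exp (- 2 * complex_of_real pi * \<i> * complex_of_real (\<omega> \<bullet> x k)))"

definition L2norm_on :: "(real ^ 'd) set \<Rightarrow> (real ^ 'd \<Rightarrow> complex) \<Rightarrow> real" where
  "L2norm_on \<Omega> f = sqrt (LINT \<omega>:\<Omega>|lborel. (cmod (f \<omega>))\<^sup>2)"

text \<open>Entry of the Fourier matrix in row \<open>\<omega> \<in> \<Omega> \<inter> \<int>\<^sup>d\<close> and column \<open>k\<close>.\<close>

definition fourier_matrix :: "('s::finite \<Rightarrow> real ^ 'd) \<Rightarrow> real ^ 'd \<Rightarrow> 's \<Rightarrow> complex" where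
  "fourier_matrix x \<omega> k = exp (- 2 * complex_of_real pi * \<i> * complex_of_real (\<omega> \<bullet> x k))"

text \<open>Smallest value of \<open>\<parallel>T u\<parallel>\<close> over unit vectors, where \<open>g u = \<parallel>T u\<parallel>\<close>. For the two operators below the
  infimum is a minimum, see \<open>sigma_min_F_attained\<close> and \<open>sigma_min_Phi_attained\<close>.\<close>

definition sigma_min :: "(complex ^ 's::finite \<Rightarrow> real) \<Rightarrow> real" where
  "sigma_min g = (INF u\<in>{u. norm u = 1}. g u)"

definition sigma_min_F :: "(real ^ 'd) set \<Rightarrow> ('s::finite \<Rightarrow> real ^ 'd) \<Rightarrow> real" where
  "sigma_min_F \<Omega> x = sigma_min (\<lambda>u. L2norm_on \<Omega> (fourier_map x u))"

definition sigma_min_Phi :: "(real ^ 'd) set \<Rightarrow> ('s::finite \<Rightarrow> real ^ 'd) \<Rightarrow> real" where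
  "sigma_min_Phi \<Omega> x =
     sigma_min (\<lambda>u. L2_set (\<lambda>\<omega>. cmod (\<Sum>k\<in>UNIV. fourier_matrix x \<omega> k * u $ k)) (\<Omega> \<inter> int_vecs))"

lemma sigma_min_attained:
  fixes g :: "complex ^ 's::finite \<Rightarrow> real"
  assumes "continuous_on UNIV g"
  shows "\<exists>u. norm u = 1 \<and> sigma_min g = g u \<and> (\<forall>v. norm v = 1 \<longrightarrow> g u \<le> g v)"
proof -
  have "sphere (0::complex ^ 's) 1 = {u. norm u = 1}"
    by (auto simp: sphere_def)
  moreover obtain w :: "complex ^ 's" where "norm w = 1"
    using vector_choose_size[of 1] by auto
  moreover have "compact (sphere (0::complex ^ 's) 1)"
    by simp
  ultimately obtain u where u: "norm u = 1" "\<forall>v. norm v = 1 \<longrightarrow> g u \<le> g v"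
    using continuous_attains_inf[of "sphere (0::complex ^ 's) 1" g]
      continuous_on_subset[OF assms, of "sphere 0 1"] by auto
  have "sigma_min g = g u"
    unfolding sigma_min_def using u by (intro cInf_eq_minimum) auto
  with u show ?thesis by blast
qed

lemma sigma_min_Phi_attained:
  "\<exists>u. norm u = 1 \<and>
     sigma_min_Phi \<Omega> x = L2_set (\<lambda>\<omega>. cmod (\<Sum>k\<in>UNIV. fourier_matrix x \<omega> k * u $ k)) (\<Omega> \<inter> int_vecs)"
  using sigma_min_attained[of "\<lambda>u. L2_set (\<lambda>\<omega>. cmod (\<Sum>k\<in>UNIV. fourier_matrix x \<omega> k * u $ k)) (\<Omega> \<inter> int_vecs)"]
  unfolding sigma_min_Phi_def L2_set_def
  by (force intro!: continuous_intros)

lemma sigma_min_F_attained: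
  assumes "compact \<Omega>"
  shows "\<exists>u. norm u = 1 \<and> sigma_min_F \<Omega> x = L2norm_on \<Omega> (fourier_map x u)"
proof -
  define e where "e k \<omega> = exp (- 2 * complex_of_real pi * \<i> * complex_of_real (\<omega> \<bullet> x k))" for k \<omega>
  define h where "h j k \<omega> = e j \<omega> * cnj (e k \<omega>)" for j k \<omega>
  have int: "set_integrable lborel \<Omega> (h j k)" for j k
    unfolding h_def e_def set_integrable_def
    by (intro borel_integrable_compact assms continuous_intros)
  have sq: "complex_of_real ((cmod (fourier_map x u \<omega>))\<^sup>2) =
      (\<Sum>j\<in>UNIV. \<Sum>k\<in>UNIV. (u $ j * cnj (u $ k)) * h j k \<omega>)" for u \<omega>
    unfolding complex_norm_square fourier_map_def e_def[symmetric] h_def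
    by (simp add: sum_product mult_ac)
  have eq: "(LINT \<omega>:\<Omega>|lborel. (cmod (fourier_map x u \<omega>))\<^sup>2) =
      Re (\<Sum>j\<in>UNIV. \<Sum>k\<in>UNIV. (u $ j * cnj (u $ k)) * (LINT \<omega>:\<Omega>|lborel. h j k \<omega>))" for u
  proof -
    have "complex_of_real (LINT \<omega>:\<Omega>|lborel. (cmod (fourier_map x u \<omega>))\<^sup>2) =
        (LINT \<omega>:\<Omega>|lborel. complex_of_real ((cmod (fourier_map x u \<omega>))\<^sup>2))"
      by (rule set_integral_complex_of_real[symmetric])
    also have "\<dots> = (LINT \<omega>|lborel. (\<Sum>j\<in>UNIV. \<Sum>k\<in>UNIV.
        (u $ j * cnj (u $ k)) * (indicator \<Omega> \<omega> *\<^sub>R h j k \<omega>)))"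
      unfolding sq set_lebesgue_integral_def by (simp add: scaleR_sum_right)
    also have "\<dots> = (\<Sum>j\<in>UNIV. \<Sum>k\<in>UNIV.
        (u $ j * cnj (u $ k)) * (LINT \<omega>:\<Omega>|lborel. h j k \<omega>))"
    proof -
      define H where "H j k \<omega> = indicator \<Omega> \<omega> *\<^sub>R h j k \<omega>" for j k \<omega>
      have "integrable lborel (H j k)" for j k
        using int[of j k] unfolding set_integrable_def H_def .
      then show ?thesis
        unfolding set_lebesgue_integral_def H_def[symmetric] by simp
    qed
    finally show ?thesis by (metis Re_complex_of_real)
  qed
  have "continuous_on UNIV (\<lambda>u. L2norm_on \<Omega> (fourier_map x u))"
    unfolding L2norm_on_def eq by (intro continuous_intros)
  from sigma_min_attained[OF this] show ?thesis
    unfolding sigma_min_F_def by blast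
qed

lemma finite_bounded_int_vecs: "finite {n \<in> int_vecs :: (real ^ 'd) set. \<forall>i. \<bar>n $ i\<bar> \<le> B}"
proof -
  have "finite {k::real. k \<in> \<int> \<and> \<bar>k\<bar> \<le> B}"
    by (rule finite_abs_int_segment)
  then have "finite (vec_lambda ` (UNIV \<rightarrow>\<^sub>E {k::real. k \<in> \<int> \<and> \<bar>k\<bar> \<le> B}) :: (real ^ 'd) set)"
    by (intro finite_imageI finite_PiE) auto
  moreover have "n \<in> vec_lambda ` (UNIV \<rightarrow>\<^sub>E {k::real. k \<in> \<int> \<and> \<bar>k\<bar> \<le> B})"
    if "n \<in> int_vecs" "\<forall>i. \<bar>n $ i\<bar> \<le> B" for n :: "real ^ 'd"
    using that by (intro image_eqI[of _ _ "vec_nth n"]) (auto simp: int_vecs_def)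
  ultimately show ?thesis
    by (elim finite_subset[rotated]) auto
qed

lemma torus_norm_attained:
  assumes N: "\<And>y i. \<bar>y $ i\<bar> \<le> N y"
  shows "\<exists>n\<in>int_vecs. torus_norm N x = N (x + n) \<and> (\<forall>n'\<in>int_vecs. N (x + n) \<le> N (x + n'))"
proof -
  define S where "S = {n \<in> int_vecs. N (x + n) \<le> N x}"
  have "\<bar>n $ i\<bar> \<le> N x + N x" if "N (x + n) \<le> N x" for n i
    using N[of x i] N[of "x + n" i] that by simp
  then have "finite S"
    by (intro finite_subset[OF _ finite_bounded_int_vecs[of "N x + N x"]]) (auto simp: S_def)
  have 0: "0 \<in> S"
    by (simp add: S_def int_vecs_def)
  obtain n where n: "n \<in> S" "\<forall>n'\<in>S. N (x + n) \<le> N (x + n')"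
    using \<open>finite S\<close> 0 arg_min_if_finite[of S "\<lambda>n. N (x + n)"] by (metis empty_iff not_le)
  have min: "N (x + n) \<le> N (x + n')" if "n' \<in> int_vecs" for n'
    using n that by (cases "n' \<in> S") (auto simp: S_def)
  have "torus_norm N x = N (x + n)"
    unfolding torus_norm_def using n min by (intro cInf_eq_minimum) (auto simp: S_def)
  with n min show ?thesis
    by (auto simp: S_def)
qed

lemma component_le_l1norm: "\<bar>y $ i\<bar> \<le> l1norm y"
  unfolding l1norm_def by (rule member_le_sum) auto

lemmas torus_norm_infnorm_attained = torus_norm_attained[of infnorm, OF component_le_infnorm_cart]
  and torus_norm_l1norm_attained = torus_norm_attained[of l1norm, OF component_le_l1norm]

end

theory Submission
  imports Defs
begin

text \<open>
  Write \<open>e(t) = exp (2 \<pi> \<i> t)\<close>, \<open>P(\<omega>) = \<Sum>\<^sub>j u\<^sub>j e(- \<omega> \<bullet> x\<^sub>j)\<close> and \<open>M = m / (2\<nu>)\<close>. The proof interpolates: for each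
  \<open>k\<close> it constructs an exponential sum \<open>h(y) = \<Sum>\<^sub>\<omega> \<alpha>\<^sub>\<omega> e(- \<omega> \<bullet> y)\<close> with finitely many frequencies, all in the
  cube of radius \<open>m - M\<close>, such that \<open>h(x\<^sub>j) = \<delta>\<^sub>j\<^sub>k\<close> and \<open>\<Sum>|\<alpha>\<^sub>\<omega>| \<le> C\<^sub>k\<close>. Then
  \<open>\<Sum>\<^sub>\<omega> \<alpha>\<^sub>\<omega> P(\<omega>\<^sub>0 + \<omega>) = u\<^sub>k e(- \<omega>\<^sub>0 \<bullet> x\<^sub>k)\<close> for every \<open>\<omega>\<^sub>0\<close>. Taking the square with the Cauchy-Schwarz
  inequality and averaging over \<open>\<omega>\<^sub>0\<close> in the cube of radius \<open>M\<close> bounds \<open>|u\<^sub>k|\<^sup>2\<close> times the volume of that cube by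
  \<open>C\<^sub>k\<^sup>2\<close> times the squared norm of \<open>P\<close> on the cube of radius \<open>m\<close>, because all translates stay in it
  (\<open>coefficient_bound_continuous\<close>, \<open>coefficient_bound_discrete\<close>). Summation over \<open>k\<close> costs the factor \<open>s\<close>.

  The function \<open>h\<close> is a product of \<open>2\<nu> - 1\<close> factors, each with frequencies in the cube of radius \<open>M\<close>
  (\<open>cardinal_function_on_clusters\<close>). The graph that joins points at distance at most \<open>\<tau>\<close> has degree below \<open>\<nu>\<close>, so
  it has a proper colouring with \<open>\<nu>\<close> colours. For each colour, \<open>x\<^sub>k\<close> together with the points of that colour far
  from \<open>x\<^sub>k\<close> is \<open>\<tau>\<close>-separated, and one factor vanishes at those far points. Each of the at most \<open>\<nu> - 1\<close> points
  near \<open>x\<^sub>k\<close> is removed by one factor \<open>e(- \<omega> \<bullet> y) - e(- \<omega> \<bullet> x\<^sub>j)\<close>, normalised at \<open>x\<^sub>k\<close>, where \<open>\<omega>\<close> is an integer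
  multiple of the sign vector of \<open>x\<^sub>j - x\<^sub>k\<close> (\<open>lagrange_factor\<close>); the phase difference is then a multiple of the
  \<open>\<ell>\<^sup>1\<close> distance, which is how that distance enters the estimate. Rounding the multiple to an integer costs at most
  \<open>\<surd>2\<close>. With \<open>E = exp (1 / (2\<beta>))\<close>, the claimed \<open>\<surd>2 (1 - E/2)\<^sup>\<nu>\<^sup>/\<^sup>2\<close> is smaller than \<open>(2 - E)\<^sup>\<nu>\<^sup>/\<^sup>2\<close> by the factor
  \<open>(\<surd>2)\<^sup>\<nu>\<^sup>-\<^sup>1\<close>, which pays for exactly these losses.

  The factor for a \<open>\<tau>\<close>-separated set comes from a signed weight \<open>\<psi>\<close> on the integer lattice that is nonpositive
  outside the cube of radius \<open>M\<close> and satisfies \<open>\<Sum>\<^sub>n \<psi>(n) e(n \<bullet> z) = 0\<close> whenever some coordinate of \<open>z\<close> has distance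
  at least \<open>\<tau>\<close> from the integers. With \<open>a(n) = (sin (\<pi> n \<tau> / 2) / n)\<^sup>4\<close>, which are up to a factor the Fourier
  coefficients of the convolution square of a triangle, one can take
  \<open>\<psi>(n) = (1 - \<Sum>\<^sub>i n\<^sub>i\<^sup>2 / M\<^sup>2) \<Prod>\<^sub>i a(n\<^sub>i)\<close>. Hence the Gram matrix of the exponentials with the weight \<open>max 0 \<psi>\<close>
  is bounded below by \<open>\<Sum>\<^sub>n \<psi>(n)\<close>, the interpolation problem has a solution, and its squared \<open>\<ell>\<^sup>1\<close> norm is at most
  \<open>\<Sum>\<^sub>n \<Prod>\<^sub>i a(n\<^sub>i)\<close> divided by \<open>\<Sum>\<^sub>n \<psi>(n)\<close>, which is \<open>1 / (1 - 3d / (\<pi>\<tau>M)\<^sup>2)\<close> (\<open>separated_interpolation\<close>). The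
  hypothesis on \<open>m\<close> gives \<open>M \<ge> \<beta>d/\<tau>\<close> and turns this into at most \<open>1 / (2 - exp (1 / (2\<beta>)))\<close>.

  The continuous operator needs no separate construction: differences of points of the unit cube have
  coordinates in \<open>(-1, 1)\<close>, so after halving all points the Euclidean separation becomes a separation on the torus,
  and integer frequencies for the halved points are half-integer frequencies for the original ones.
\<close>

section \<open>Two cosine series\<close>

definition cos_series :: "nat \<Rightarrow> real \<Rightarrow> real" where
  "cos_series p x = (\<Sum>n. cos (2 * pi * real (Suc n) * x) / real (Suc n) ^ p)"

lemma summable_inverse_Suc_power:
  assumes "2 \<le> p" shows "summable (\<lambda>n. 1 / real (Suc n) ^ p)"
  using inverse_power_summable[of p, where 'a=real] assms
  by (subst summable_Suc_iff) (simp add: inverse_eq_divide)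

lemma cos_term_bound: "norm (cos t / real (Suc n) ^ p) \<le> 1 / real (Suc n) ^ p"
  by (simp add: divide_right_mono del: of_nat_Suc)

lemma cos_series_sums:
  assumes "2 \<le> p"
  shows "(\<lambda>n. cos (2 * pi * real (Suc n) * x) / real (Suc n) ^ p) sums cos_series p x"
  unfolding cos_series_def
  by (intro summable_sums summable_comparison_test'[OF summable_inverse_Suc_power[OF assms]] cos_term_bound)

lemma cos_series_continuous:
  assumes "2 \<le> p" shows "continuous_on UNIV (cos_series p)"
proof -
  have "uniform_limit UNIV (\<lambda>N x. \<Sum>n<N. cos (2 * pi * real (Suc n) * x) / real (Suc n) ^ p)
          (cos_series p) sequentially"
    unfolding cos_series_def [abs_def]
    by (rule Weierstrass_m_test[OF cos_term_bound summable_inverse_Suc_power[OF assms]])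
  then show ?thesis
    by (rule uniform_limit_theorem[rotated]) (auto intro!: always_eventually continuous_intros simp del: of_nat_Suc)
qed

lemma cos_series_minus: "cos_series p (- x) = cos_series p x"
  by (simp add: cos_series_def)

lemma cos_series_plus_int: "cos_series p (x + of_int k) = cos_series p x"
proof -
  have "cos (2 * pi * real (Suc n) * (x + of_int k)) = cos (2 * pi * real (Suc n) * x)" for n
  proof -
    have "2 * pi * real (Suc n) * (x + of_int k) = 2 * pi * real (Suc n) * x + 2 * pi * of_int (int (Suc n) * k)"
      by (simp add: algebra_simps)
    then show ?thesis
      by (simp only: cos_add cos_int_2pin sin_int_2pin)
  qed
  then show ?thesis by (simp only: cos_series_def)
qed

text \<open>The imaginary part of the power series of the complex logarithm; inside the disc it is, up to the factor
  \<open>- 2\<pi>\<close>, the derivative of the Abel means of the series for \<open>p = 2\<close>.\<close>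

lemma sin_log_series:
  assumes "0 \<le> r" "r < 1"
  shows "(\<lambda>n. r ^ Suc n * sin (2 * pi * real (Suc n) * x) / real (Suc n)) sums
           (- Im (Ln (1 - of_real r * cis (2 * pi * x))))"
proof -
  define z where "z = of_real r * cis (2 * pi * x)"
  have "norm (- z) < 1" using assms by (simp add: z_def norm_mult)
  from Ln_series'[OF this] have "(\<lambda>n. - (z ^ n / of_nat n)) sums ln (1 - z)" by simp
  from sums_minus[OF this] have *: "(\<lambda>n. z ^ n / of_nat n) sums (- ln (1 - z))" by simp
  have "(\<lambda>n. z ^ Suc n / of_nat (Suc n)) sums (- ln (1 - z))"
    using * by (subst sums_Suc_iff) simp
  from sums_Im[OF this] have "(\<lambda>n. Im (z ^ Suc n / of_nat (Suc n))) sums (- Im (ln (1 - z)))" by simp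
  moreover have "Im (z ^ Suc n / of_nat (Suc n)) = r ^ Suc n * sin (2 * pi * real (Suc n) * x) / real (Suc n)" for n
  proof -
    have "z ^ Suc n = of_real (r ^ Suc n) * cis (real (Suc n) * (2 * pi * x))"
      by (simp only: z_def power_mult_distrib Complex.DeMoivre of_real_power)
    then have "Im (z ^ Suc n / of_nat (Suc n)) = Im (of_real (r ^ Suc n / real (Suc n)) * cis (real (Suc n) * (2 * pi * x)))"
      by (simp only: of_real_divide of_real_of_nat_eq times_divide_eq_left)
    also have "\<dots> = r ^ Suc n / real (Suc n) * sin (real (Suc n) * (2 * pi * x))"
      by (simp del: of_nat_Suc of_real_power of_real_divide power_Suc)
    finally show ?thesis by (simp only: times_divide_eq_left mult_ac)
  qed
  ultimately show ?thesis unfolding z_def by (simp only: )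
qed

text \<open>On the boundary of the disc the logarithm has a linear argument. This is the source of the polynomial below.\<close>

lemma Im_Ln_one_minus_cis:
  assumes "0 < x" "x < 1"
  shows "Im (Ln (1 - cis (2 * pi * x))) = pi * (x - 1 / 2)"
proof -
  have s: "0 < sin (pi * x)" using assms by (intro sin_gt_zero) auto
  have "1 - cis (2 * pi * x) = of_real (2 * sin (pi * x)) * cis (pi * (x - 1 / 2))"
  proof -
    have "cos (2 * pi * x) = 1 - 2 * sin (pi * x) ^ 2" "sin (2 * pi * x) = 2 * sin (pi * x) * cos (pi * x)"
      using cos_double_sin[of "pi * x"] sin_double[of "pi * x"] by (simp_all add: mult_ac)
    moreover have "cos (pi * (x - 1 / 2)) = sin (pi * x)" "sin (pi * (x - 1 / 2)) = - cos (pi * x)"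
      by (simp_all add: right_diff_distrib cos_diff sin_diff)
    ultimately show ?thesis
      by (simp add: complex_eq_iff power2_eq_square)
  qed
  also have "Im (Ln \<dots>) = pi * (x - 1 / 2)"
  proof -
    have "of_real (2 * sin (pi * x)) * cis (pi * (x - 1 / 2)) = exp (Complex (ln (2 * sin (pi * x))) (pi * (x - 1 / 2)))"
      using s by (simp add: exp_eq_polar)
    then have "Ln (of_real (2 * sin (pi * x)) * cis (pi * (x - 1 / 2))) = Complex (ln (2 * sin (pi * x))) (pi * (x - 1 / 2))"
    proof -
      assume h: "of_real (2 * sin (pi * x)) * cis (pi * (x - 1 / 2)) = exp (Complex (ln (2 * sin (pi * x))) (pi * (x - 1 / 2)))"
      have "pi * x < pi * 1" "0 < pi * x"
        using assms pi_gt_zero by (auto simp del: mult_1_right)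
      then have "- pi < pi * (x - 1 / 2)" "pi * (x - 1 / 2) \<le> pi"
        using pi_gt_zero unfolding right_diff_distrib by linarith+
      then show ?thesis unfolding h by (intro Ln_exp) auto
    qed
    then show ?thesis by simp
  qed
  finally show ?thesis .
qed

lemma abel_cos_series_derivative:
  assumes "0 \<le> r" "r < 1"
  shows "((\<lambda>x. \<Sum>n. r ^ Suc n * cos (2 * pi * real (Suc n) * x) / real (Suc n) ^ 2) has_field_derivative
          2 * pi * Im (Ln (1 - of_real r * cis (2 * pi * x)))) (at x)"
proof -
  define f' where "f' n x = - (2 * pi) * (r ^ Suc n * sin (2 * pi * real (Suc n) * x) / real (Suc n))" for n x
  have sg: "summable (\<lambda>n. 2 * pi * r ^ Suc n)"
    using assms by (intro summable_mult) (simp add: summable_mult)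
  have bound: "norm (f' n x) \<le> 2 * pi * r ^ Suc n" for n x
  proof -
    have "\<bar>sin (2 * pi * real (Suc n) * x) / real (Suc n)\<bar> \<le> 1 / 1"
      unfolding abs_divide by (intro frac_le) auto
    then have "r ^ Suc n * \<bar>sin (2 * pi * real (Suc n) * x) / real (Suc n)\<bar> \<le> r ^ Suc n * 1"
      using assms by (intro mult_left_mono) auto
    then have "2 * pi * (r ^ Suc n * \<bar>sin (2 * pi * real (Suc n) * x) / real (Suc n)\<bar>) \<le> 2 * pi * r ^ Suc n"
      by (intro mult_left_mono) auto
    moreover have "norm (f' n x) = 2 * pi * (r ^ Suc n * \<bar>sin (2 * pi * real (Suc n) * x) / real (Suc n)\<bar>)"
      using assms unfolding f'_def by (simp add: abs_mult del: of_nat_Suc power_Suc)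
    ultimately show ?thesis by simp
  qed
  have d: "((\<lambda>x. \<Sum>n. r ^ Suc n * cos (2 * pi * real (Suc n) * x) / real (Suc n) ^ 2) has_field_derivative
      (\<Sum>n. f' n x)) (at x)"
  proof (rule has_field_derivative_series'(2)[of UNIV _ f' 0])
    show "((\<lambda>x. r ^ Suc n * cos (2 * pi * real (Suc n) * x) / real (Suc n) ^ 2) has_field_derivative f' n x) (at x)" for n x
      unfolding f'_def
      by (rule derivative_eq_intros refl | simp add: power2_eq_square del: of_nat_Suc power_Suc)+
    show "uniformly_convergent_on UNIV (\<lambda>n x. \<Sum>i<n. f' i x)"
      by (rule Weierstrass_m_test'[OF bound sg])
    show "summable (\<lambda>n. r ^ Suc n * cos (2 * pi * real (Suc n) * 0) / real (Suc n) ^ 2)"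
    proof (rule summable_comparison_test'[of "\<lambda>n. 1 * r ^ Suc n"])
      show "summable (\<lambda>n. 1 * r ^ Suc n)" using assms by (intro summable_mult) (simp add: summable_mult)
      fix n :: nat
      have "r ^ Suc n / real (Suc n) ^ 2 \<le> r ^ Suc n / 1"
        using assms by (intro frac_le) auto
      then show "norm (r ^ Suc n * cos (2 * pi * real (Suc n) * 0) / real (Suc n) ^ 2) \<le> 1 * r ^ Suc n"
        using assms by (simp add: abs_mult del: of_nat_Suc power_Suc)
    qed
  qed auto
  have "(\<lambda>n. f' n x) sums (- (2 * pi) * (- Im (Ln (1 - of_real r * cis (2 * pi * x)))))"
    unfolding f'_def by (intro sums_mult sin_log_series assms)
  then have "(\<Sum>n. f' n x) = 2 * pi * Im (Ln (1 - of_real r * cis (2 * pi * x)))"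
    by (simp add: sums_iff)
  with d show ?thesis by simp
qed

text \<open>The termwise derivative of the series for \<open>p = 2\<close> converges only conditionally, so the Abel means are
  integrated instead: their derivatives are bounded by \<open>\<pi>\<^sup>2\<close> and converge pointwise to a linear function.\<close>

lemma cos_series_2_increment:
  assumes "0 < a" "a \<le> b" "b < 1"
  shows "cos_series 2 b - cos_series 2 a = pi\<^sup>2 * (b\<^sup>2 - b) - pi\<^sup>2 * (a\<^sup>2 - a)"
proof -
  define r where "r k = 1 - 1 / real (k + 2)" for k
  have r: "0 \<le> r k" "r k < 1" for k by (auto simp: r_def)
  have r1: "r \<longlonglongrightarrow> 1"
    unfolding r_def using tendsto_diff[OF tendsto_const LIMSEQ_ignore_initial_segment[OF lim_1_over_n, of 2], of "1::real"]
    by simp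
  define G where "G k x = (\<Sum>n. r k ^ Suc n * cos (2 * pi * real (Suc n) * x) / real (Suc n) ^ 2)" for k x
  define g where "g k x = 2 * pi * Im (Ln (1 - of_real (r k) * cis (2 * pi * x)))" for k x
  have Glim: "(\<lambda>k. G k x) \<longlonglongrightarrow> cos_series 2 x" for x
    unfolding G_def cos_series_def
  proof (rule tannerys_theorem[THEN conjunct2, THEN conjunct2])
    show "(\<lambda>k. r k ^ Suc n * cos (2 * pi * real (Suc n) * x) / real (Suc n) ^ 2) \<longlonglongrightarrow>
        cos (2 * pi * real (Suc n) * x) / real (Suc n) ^ 2" for n
      using tendsto_mult[OF tendsto_power[OF r1, of "Suc n"] tendsto_const[of "cos (2 * pi * real (Suc n) * x) / real (Suc n) ^ 2"]]
      by (simp del: of_nat_Suc power_Suc)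
    show "summable (\<lambda>n. 1 / real (Suc n) ^ 2)" by (rule summable_inverse_Suc_power) simp
    have "norm (r k ^ Suc n * cos (2 * pi * real (Suc n) * x) / real (Suc n) ^ 2) \<le> 1 / real (Suc n) ^ 2" for k n
    proof -
      have "r k ^ Suc n \<le> 1" using r[of k] by (intro power_le_one) auto
      then have "\<bar>r k ^ Suc n\<bar> * \<bar>cos (2 * pi * real (Suc n) * x)\<bar> \<le> 1 * 1"
        using r[of k] by (intro mult_mono) (auto simp del: power_Suc)
      then show ?thesis by (simp add: abs_mult divide_right_mono del: of_nat_Suc power_Suc)
    qed
    then show "\<forall>\<^sub>F (n, k) in sequentially \<times>\<^sub>F sequentially.
       norm (r k ^ Suc n * cos (2 * pi * real (Suc n) * x) / (real (Suc n))\<^sup>2) \<le> 1 / (real (Suc n))\<^sup>2"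
      by (intro always_eventually) (auto simp del: of_nat_Suc power_Suc)
  qed simp
  \<comment> \<open>Positivity of the real part keeps the argument of the logarithm within \<open>\<pi> / 2\<close>.\<close>
  have re: "0 < Re (1 - of_real (r k) * cis t)" for k t
  proof -
    have "r k * cos t \<le> r k * 1" using r[of k] by (intro mult_left_mono) auto
    then show ?thesis using r(2)[of k] by simp
  qed
  have int: "(g k has_integral (G k b - G k a)) {a..b}" for k
  proof (rule fundamental_theorem_of_calculus)
    show "a \<le> b" by fact
    fix x assume "x \<in> {a..b}"
    show "(G k has_vector_derivative g k x) (at x within {a..b})"
      using abel_cos_series_derivative[OF r, of k x] unfolding G_def [abs_def] g_def
      by (simp add: has_real_derivative_iff_has_vector_derivative has_vector_derivative_at_within)
  qed
  have lim: "(\<lambda>k. g k x) \<longlonglongrightarrow> 2 * pi * (pi * (x - 1 / 2))" if "x \<in> {a..b}" for x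
  proof -
    have x: "0 < x" "x < 1" using that assms by auto
    have "cos (2 * pi * x) < 1"
    proof -
      have "cos (2 * pi * x) = 1 - 2 * sin (pi * x) ^ 2"
        using cos_double_sin[of "pi * x"] by (simp add: mult_ac)
      moreover have "0 < sin (pi * x)" using x by (intro sin_gt_zero) auto
      ultimately show ?thesis by simp
    qed
    then have "1 - of_real 1 * cis (2 * pi * x) \<notin> \<real>\<^sub>\<le>\<^sub>0"
      by (auto simp: complex_nonpos_Reals_iff)
    then have "(\<lambda>k. g k x) \<longlonglongrightarrow> 2 * pi * Im (Ln (1 - of_real 1 * cis (2 * pi * x)))"
      unfolding g_def by (intro tendsto_intros tendsto_Ln r1)
    then show ?thesis using Im_Ln_one_minus_cis[OF x] by simp
  qed
  have bd: "norm (g k x) \<le> 2 * pi * (pi / 2)" for k x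
  proof -
    have "\<bar>Im (Ln (1 - of_real (r k) * cis (2 * pi * x)))\<bar> < pi / 2"
      using re[of k "2 * pi * x"] Re_Ln_pos_lt[of "1 - of_real (r k) * cis (2 * pi * x)"]
      by (metis complex_eq_iff less_irrefl zero_complex.simps(1))
    then have "2 * pi * \<bar>Im (Ln (1 - of_real (r k) * cis (2 * pi * x)))\<bar> \<le> 2 * pi * (pi / 2)"
      by (intro mult_left_mono) auto
    then show ?thesis by (simp add: g_def abs_mult)
  qed
  have "(\<lambda>k. integral {a..b} (g k)) \<longlonglongrightarrow> integral {a..b} (\<lambda>x. 2 * pi * (pi * (x - 1 / 2)))"
    using lim bd int[THEN has_integral_integrable]
    by (intro dominated_convergence(2)[where h="\<lambda>x. 2 * pi * (pi / 2)"]) auto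
  then have "(\<lambda>k. G k b - G k a) \<longlonglongrightarrow> integral {a..b} (\<lambda>x. 2 * pi * (pi * (x - 1 / 2)))"
    unfolding integral_unique[OF int] .
  moreover have "(\<lambda>k. G k b - G k a) \<longlonglongrightarrow> cos_series 2 b - cos_series 2 a"
    by (intro tendsto_diff Glim)
  ultimately have "cos_series 2 b - cos_series 2 a = integral {a..b} (\<lambda>x. 2 * pi * (pi * (x - 1 / 2)))"
    by (rule LIMSEQ_unique[rotated])
  also have "((\<lambda>x. 2 * pi * (pi * (x - 1 / 2))) has_integral (pi\<^sup>2 * (b\<^sup>2 - b) - pi\<^sup>2 * (a\<^sup>2 - a))) {a..b}"
    using assms(2)
    by (intro fundamental_theorem_of_calculus)
      (auto intro!: derivative_eq_intros simp flip: has_real_derivative_iff_has_vector_derivative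
        simp: power2_eq_square algebra_simps)
  then have "integral {a..b} (\<lambda>x. 2 * pi * (pi * (x - 1 / 2))) = pi\<^sup>2 * (b\<^sup>2 - b) - pi\<^sup>2 * (a\<^sup>2 - a)"
    by (rule integral_unique)
  finally show ?thesis .
qed

lemma cos_series_2_eq:
  assumes "0 \<le> x" "x \<le> 1"
  shows "cos_series 2 x = cos_series 2 0 + pi\<^sup>2 * (x\<^sup>2 - x)"
proof -
  define D where "D x = cos_series 2 x - pi\<^sup>2 * (x\<^sup>2 - x)" for x
  have cont: "continuous_on (closure {0<..<1}) D"
    unfolding D_def
    by (intro continuous_intros continuous_on_subset[OF cos_series_continuous[of 2]]) auto
  have "D x = D (1 / 2)" if "x \<in> closure {0<..<1}" for x
  proof (rule continuous_constant_on_closure[OF cont _ that])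
    fix x :: real assume "x \<in> {0<..<1}"
    then show "D x = D (1 / 2)"
      using cos_series_2_increment[of x "1/2"] cos_series_2_increment[of "1/2" x]
      by (cases "x \<le> 1 / 2") (auto simp: D_def)
  qed
  from this[of x] this[of 0] show ?thesis
    using assms by (simp add: closure_greaterThanLessThan D_def)
qed

text \<open>Two termwise differentiations lead back to \<open>p = 2\<close>. The first derivative is a sine series and vanishes at \<open>0\<close>,
  which removes the linear term. The constants \<open>cos_series 2 0\<close> and \<open>cos_series 4 0\<close> can stay unevaluated
  since they disappear in the fourth differences taken later.\<close>

lemma cos_series_4_eq:
  assumes "0 \<le> x" "x \<le> 1"
  shows "cos_series 4 x = cos_series 4 0 - 4 * pi\<^sup>2 * (pi\<^sup>2 * (x ^ 4 / 12 - x ^ 3 / 6) + cos_series 2 0 * x\<^sup>2 / 2)"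
proof -
  define T where "T x = (\<Sum>n. sin (2 * pi * real (Suc n) * x) / real (Suc n) ^ 3)" for x
  have sin_bound: "norm (c * (sin t / real (Suc n) ^ 3)) \<le> \<bar>c\<bar> * (1 / real (Suc n) ^ 3)" for c t n
    unfolding norm_mult by (intro mult_mono) (auto simp: divide_right_mono simp del: of_nat_Suc)
  have cos_bound: "norm (c * (cos t / real (Suc n) ^ 2)) \<le> \<bar>c\<bar> * (1 / real (Suc n) ^ 2)" for c t n
    unfolding norm_mult by (intro mult_mono) (auto simp: divide_right_mono simp del: of_nat_Suc)
  have d4: "(cos_series 4 has_field_derivative - (2 * pi) * T x) (at x)" for x
  proof -
    have sm: "summable (\<lambda>n. sin (2 * pi * real (Suc n) * x) / real (Suc n) ^ 3)"
      by (rule summable_comparison_test'[OF summable_inverse_Suc_power[of 3]])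
        (auto simp: divide_right_mono simp del: of_nat_Suc)
    have "(cos_series 4 has_field_derivative (\<Sum>n. - (2 * pi) * (sin (2 * pi * real (Suc n) * x) / real (Suc n) ^ 3))) (at x)"
      unfolding cos_series_def [abs_def]
    proof (rule has_field_derivative_series'(2)[of UNIV _ _ 0])
      show "((\<lambda>x. cos (2 * pi * real (Suc n) * x) / real (Suc n) ^ 4) has_field_derivative
          - (2 * pi) * (sin (2 * pi * real (Suc n) * x) / real (Suc n) ^ 3)) (at x)" for n x
        by (rule derivative_eq_intros refl | simp add: eval_nat_numeral del: of_nat_Suc)+
      show "uniformly_convergent_on UNIV (\<lambda>n x. \<Sum>i<n. - (2 * pi) * (sin (2 * pi * real (Suc i) * x) / real (Suc i) ^ 3))"
        by (rule Weierstrass_m_test'[OF sin_bound]) (intro summable_mult summable_inverse_Suc_power, simp)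
      show "summable (\<lambda>n. cos (2 * pi * real (Suc n) * 0) / real (Suc n) ^ 4)"
        using cos_series_sums[of 4 0] by (auto simp: sums_iff)
    qed auto
    also have "(\<Sum>n. - (2 * pi) * (sin (2 * pi * real (Suc n) * x) / real (Suc n) ^ 3)) = - (2 * pi) * T x"
      unfolding T_def by (rule suminf_mult[OF sm])
    finally show ?thesis .
  qed
  have dT: "(T has_field_derivative 2 * pi * cos_series 2 x) (at x)" for x
  proof -
    have "(T has_field_derivative (\<Sum>n. 2 * pi * (cos (2 * pi * real (Suc n) * x) / real (Suc n) ^ 2))) (at x)"
      unfolding T_def [abs_def]
    proof (rule has_field_derivative_series'(2)[of UNIV _ _ 0])
      show "((\<lambda>x. sin (2 * pi * real (Suc n) * x) / real (Suc n) ^ 3) has_field_derivative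
          2 * pi * (cos (2 * pi * real (Suc n) * x) / real (Suc n) ^ 2)) (at x)" for n x
        by (rule derivative_eq_intros refl | simp add: eval_nat_numeral del: of_nat_Suc)+
      show "uniformly_convergent_on UNIV (\<lambda>n x. \<Sum>i<n. 2 * pi * (cos (2 * pi * real (Suc i) * x) / real (Suc i) ^ 2))"
        by (rule Weierstrass_m_test'[OF cos_bound]) (intro summable_mult summable_inverse_Suc_power, simp)
    qed auto
    also have "(\<Sum>n. 2 * pi * (cos (2 * pi * real (Suc n) * x) / real (Suc n) ^ 2)) = 2 * pi * cos_series 2 x"
      unfolding cos_series_def using cos_series_sums[of 2 x] by (intro suminf_mult) (auto simp: sums_iff)
    finally show ?thesis .
  qed
  define C where "C = cos_series 2 0"
  have T: "T x = 2 * pi * (pi\<^sup>2 * (x ^ 3 / 3 - x\<^sup>2 / 2) + C * x)" if "x \<in> {0..1}" for x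
  proof -
    have "((\<lambda>x. T x - 2 * pi * (pi\<^sup>2 * (x ^ 3 / 3 - x\<^sup>2 / 2) + C * x)) has_field_derivative 0) (at x within {0..1})"
      if "x \<in> {0..1}" for x
    proof -
      have e: "cos_series 2 x = C + pi\<^sup>2 * (x\<^sup>2 - x)"
        using that cos_series_2_eq[of x] by (simp add: C_def)
      have "((\<lambda>x. 2 * pi * (pi\<^sup>2 * (x ^ 3 / 3 - x\<^sup>2 / 2) + C * x)) has_field_derivative
          2 * pi * (pi\<^sup>2 * (x\<^sup>2 - x) + C)) (at x within {0..1})"
        by (auto intro!: derivative_eq_intros)
      from DERIV_diff[OF DERIV_subset[OF dT subset_UNIV] this] show ?thesis
        by (simp add: e add.commute)
    qed
    then have "\<exists>c. \<forall>x\<in>{0..1}. T x - 2 * pi * (pi\<^sup>2 * (x ^ 3 / 3 - x\<^sup>2 / 2) + C * x) = c"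
      by (intro has_field_derivative_zero_constant) auto
    then obtain c where c: "\<And>x. x\<in>{0..1} \<Longrightarrow> T x - 2 * pi * (pi\<^sup>2 * (x ^ 3 / 3 - x\<^sup>2 / 2) + C * x) = c" by blast
    have "T 0 = 0" by (simp add: T_def)
    then show ?thesis using c[OF that] c[of 0] by simp
  qed
  define p where "p x = - 4 * pi\<^sup>2 * (pi\<^sup>2 * (x ^ 4 / 12 - x ^ 3 / 6) + C * x\<^sup>2 / 2)" for x :: real
  have "((\<lambda>x. cos_series 4 x - p x) has_field_derivative 0) (at x within {0..1})"
    if "x \<in> {0..1}" for x
  proof -
    have "(p has_field_derivative - 4 * pi\<^sup>2 * (pi\<^sup>2 * (x ^ 3 / 3 - x\<^sup>2 / 2) + C * x)) (at x within {0..1})"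
      unfolding p_def [abs_def]
      by (intro DERIV_cmult DERIV_add) (auto intro!: derivative_eq_intros)
    from DERIV_diff[OF DERIV_subset[OF d4 subset_UNIV] this] show ?thesis
      by (simp add: T[OF that] power2_eq_square)
  qed
  then have "\<exists>c. \<forall>x\<in>{0..1}. cos_series 4 x - p x = c"
    by (intro has_field_derivative_zero_constant) auto
  then obtain c where c: "\<And>x. x\<in>{0..1} \<Longrightarrow> cos_series 4 x - p x = c" by blast
  show ?thesis using c[of x] c[of 0] assms by (simp add: p_def C_def)
qed

section \<open>A one-dimensional kernel with compactly supported transform\<close>

definition ee :: "real \<Rightarrow> complex" where
  "ee t = cis (2 * pi * t)"

lemma ee_add: "ee (s + t) = ee s * ee t"
  by (simp add: ee_def cis_mult algebra_simps)

lemma ee_0 [simp]: "ee 0 = 1" by (simp add: ee_def)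

lemma norm_ee [simp]: "cmod (ee t) = 1" by (simp add: ee_def)

lemma cnj_ee: "cnj (ee t) = ee (- t)" by (simp add: ee_def cis_cnj)

lemma ee_sum: "ee (\<Sum>i\<in>A. f i) = (\<Prod>i\<in>A. ee (f i))"
  by (induction A rule: infinite_finite_induct) (simp_all add: ee_add)

lemma ee_int: "t \<in> \<int> \<Longrightarrow> ee t = 1"
  by (auto simp: ee_def complex_eq_iff cos_int_2pin sin_int_2pin elim!: Ints_cases)

text \<open>Up to a constant factor, the Fourier coefficients of the convolution square of a triangle function of
  half-width \<open>\<tau> / 2\<close>; the value at \<open>0\<close> is the limit of the formula for \<open>n \<noteq> 0\<close>.\<close>

definition jackson_weight :: "real \<Rightarrow> int \<Rightarrow> real" where
  "jackson_weight \<tau> n = (if n = 0 then (pi * \<tau> / 2) ^ 4 else (sin (pi * of_int n * \<tau> / 2) / of_int n) ^ 4)"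

lemma jackson_weight_nonneg: "0 \<le> jackson_weight \<tau> n"
  by (simp add: jackson_weight_def zero_le_even_power)

lemma jackson_weight_minus: "jackson_weight \<tau> (- n) = jackson_weight \<tau> n"
  by (simp add: jackson_weight_def)

definition fourth_difference :: "real \<Rightarrow> (real \<Rightarrow> real) \<Rightarrow> real \<Rightarrow> real" where
  "fourth_difference h S x = 6 * S x - 4 * (S (x + h) + S (x - h)) + (S (x + 2 * h) + S (x - 2 * h))"

text \<open>Multiplication by \<open>16 sin\<^sup>4\<close> is a fourth central difference on the transform side. This is what makes the
  transform of the weights vanish wherever the cosine series is a cubic polynomial, and constant wherever it is a quartic.\<close>

lemma sin_power4_times_cos:
  fixes \<theta> \<phi> :: real
  shows "16 * (sin \<phi> ^ 4 * cos \<theta>) =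
    6 * cos \<theta> - 4 * (cos (\<theta> + 2 * \<phi>) + cos (\<theta> - 2 * \<phi>)) + (cos (\<theta> + 4 * \<phi>) + cos (\<theta> - 4 * \<phi>))"
proof -
  have "cos (2 * \<phi>) = 1 - 2 * sin \<phi> ^ 2" by (rule cos_double_sin)
  moreover have "cos (4 * \<phi>) = 2 * cos (2 * \<phi>) ^ 2 - 1"
    using cos_double_cos[of "2 * \<phi>"] by simp
  ultimately have c: "cos (2 * \<phi>) = 1 - 2 * sin \<phi> ^ 2" "cos (4 * \<phi>) = 2 * (1 - 2 * sin \<phi> ^ 2) ^ 2 - 1"
    by simp_all
  have "cos (\<theta> + t) + cos (\<theta> - t) = 2 * cos \<theta> * cos t" for t
    by (simp add: cos_add cos_diff)
  then show ?thesis
    unfolding c by (simp only: c) (simp add: algebra_simps eval_nat_numeral)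
qed

lemma symmetric_exp_sum:
  assumes "\<And>n. f (- n) = f n"
  shows "(\<Sum>n\<in>{- int N..int N}. of_real (f n) * ee (of_int n * x)) =
    of_real (f 0 + 2 * (\<Sum>n<N. f (int (Suc n)) * cos (2 * pi * real (Suc n) * x)))"
proof (induction N)
  case (Suc N)
  have *: "{- int (Suc N)..int (Suc N)} = insert (int (Suc N)) (insert (- int (Suc N)) {- int N..int N})"
    by auto
  have "ee (of_int (int (Suc N)) * x) + ee (of_int (- int (Suc N)) * x) = of_real (2 * cos (2 * pi * real (Suc N) * x))"
  proof -
    have "ee t + ee (- t) = of_real (2 * cos (2 * pi * t))" for t
      using complex_add_cnj[of "ee t"] unfolding cnj_ee by (simp add: ee_def)
    from this[of "of_int (int (Suc N)) * x"] show ?thesis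
      by (simp only: of_int_minus mult_minus_left of_int_of_nat_eq mult.assoc)
  qed
  then have "of_real (f (int (Suc N))) * ee (of_int (int (Suc N)) * x) +
      of_real (f (- int (Suc N))) * ee (of_int (- int (Suc N)) * x) =
      of_real (2 * (f (int (Suc N)) * cos (2 * pi * real (Suc N) * x)))"
    unfolding assms distrib_left[symmetric] by simp
  then show ?case
    unfolding * using Suc by (simp add: algebra_simps del: of_nat_Suc)
qed simp

lemma sin_power4_cos_series:
  assumes "2 \<le> p"
  shows "(\<lambda>n. sin (pi * real (Suc n) * \<tau> / 2) ^ 4 * cos (2 * pi * real (Suc n) * x) / real (Suc n) ^ p)
     sums (fourth_difference (\<tau> / 2) (cos_series p) x / 16)"
proof -
  have "sin (pi * real (Suc n) * \<tau> / 2) ^ 4 * cos (2 * pi * real (Suc n) * x) / real (Suc n) ^ p =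
     (6 * (cos (2 * pi * real (Suc n) * x) / real (Suc n) ^ p)
      - 4 * (cos (2 * pi * real (Suc n) * (x + \<tau> / 2)) / real (Suc n) ^ p
           + cos (2 * pi * real (Suc n) * (x - \<tau> / 2)) / real (Suc n) ^ p)
      + (cos (2 * pi * real (Suc n) * (x + 2 * (\<tau> / 2))) / real (Suc n) ^ p
           + cos (2 * pi * real (Suc n) * (x - 2 * (\<tau> / 2))) / real (Suc n) ^ p)) / 16" for n
  proof -
    define \<theta> \<phi> where "\<theta> = 2 * pi * real (Suc n) * x" and "\<phi> = pi * real (Suc n) * \<tau> / 2"
    have e: "2 * pi * real (Suc n) * (x + \<tau> / 2) = \<theta> + 2 * \<phi>" "2 * pi * real (Suc n) * (x - \<tau> / 2) = \<theta> - 2 * \<phi>"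
      "2 * pi * real (Suc n) * (x + 2 * (\<tau> / 2)) = \<theta> + 4 * \<phi>" "2 * pi * real (Suc n) * (x - 2 * (\<tau> / 2)) = \<theta> - 4 * \<phi>"
      by (simp_all add: \<theta>_def \<phi>_def algebra_simps)
    have "sin \<phi> ^ 4 * cos \<theta> = (6 * cos \<theta> - 4 * (cos (\<theta> + 2 * \<phi>) + cos (\<theta> - 2 * \<phi>)) + (cos (\<theta> + 4 * \<phi>) + cos (\<theta> - 4 * \<phi>))) / 16"
      using sin_power4_times_cos[of \<phi> \<theta>] by simp
    then show ?thesis
      unfolding e \<theta>_def[symmetric] \<phi>_def[symmetric]
      by (simp add: add_divide_distrib diff_divide_distrib del: of_nat_Suc)
  qed
  then show ?thesis
    unfolding fourth_difference_def
    by (simp only:) (intro sums_divide sums_add sums_diff sums_mult cos_series_sums assms)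
qed

text \<open>The weights are even, so the sum is a cosine series plus the term \<open>(\<pi>\<tau>/2)\<^sup>4\<close> for \<open>n = 0\<close>.\<close>

lemma jackson_weight_series:
  "(\<lambda>N. \<Sum>n\<in>{- int N..int N}. of_real (jackson_weight \<tau> n) * ee (of_int n * x))
     \<longlonglongrightarrow> of_real ((pi * \<tau> / 2) ^ 4 + fourth_difference (\<tau> / 2) (cos_series 4) x / 8)"
proof -
  have "(\<lambda>n. jackson_weight \<tau> (int (Suc n)) * cos (2 * pi * real (Suc n) * x)) sums (fourth_difference (\<tau> / 2) (cos_series 4) x / 16)"
    using sin_power4_cos_series[of 4 \<tau> x] by (simp add: jackson_weight_def power_divide mult_ac)
  then have "(\<lambda>N. jackson_weight \<tau> 0 + 2 * (\<Sum>n<N. jackson_weight \<tau> (int (Suc n)) * cos (2 * pi * real (Suc n) * x)))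
      \<longlonglongrightarrow> jackson_weight \<tau> 0 + 2 * (fourth_difference (\<tau> / 2) (cos_series 4) x / 16)"
    unfolding sums_def by (intro tendsto_intros)
  from tendsto_of_real[OF this, where 'a=complex] show ?thesis
    unfolding symmetric_exp_sum[of "jackson_weight \<tau>", OF jackson_weight_minus] by (simp add: jackson_weight_def)
qed

lemma square_jackson_weight_series:
  "(\<lambda>N. \<Sum>n\<in>{- int N..int N}. of_real ((of_int n)\<^sup>2 * jackson_weight \<tau> n) * ee (of_int n * x))
     \<longlonglongrightarrow> of_real (fourth_difference (\<tau> / 2) (cos_series 2) x / 8)"
proof -
  have e: "(of_int (int (Suc n)))\<^sup>2 * jackson_weight \<tau> (int (Suc n)) = sin (pi * real (Suc n) * \<tau> / 2) ^ 4 / real (Suc n) ^ 2" for n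
    by (simp add: jackson_weight_def power_divide eval_nat_numeral field_simps del: of_nat_Suc)
  have "(\<lambda>n. (of_int (int (Suc n)))\<^sup>2 * jackson_weight \<tau> (int (Suc n)) * cos (2 * pi * real (Suc n) * x)) sums (fourth_difference (\<tau> / 2) (cos_series 2) x / 16)"
    using sin_power4_cos_series[of 2 \<tau> x] unfolding e by (simp add: mult_ac)
  then have "(\<lambda>N. (of_int 0)\<^sup>2 * jackson_weight \<tau> 0 + 2 * (\<Sum>n<N. (of_int (int (Suc n)))\<^sup>2 * jackson_weight \<tau> (int (Suc n)) * cos (2 * pi * real (Suc n) * x)))
      \<longlonglongrightarrow> (of_int 0)\<^sup>2 * jackson_weight \<tau> 0 + 2 * (fourth_difference (\<tau> / 2) (cos_series 2) x / 16)"
    unfolding sums_def by (intro tendsto_intros)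
  from tendsto_of_real[OF this, where 'a=complex] show ?thesis
    by (subst symmetric_exp_sum) (simp_all add: jackson_weight_minus)
qed

lemma fourth_difference_polynomial:
  fixes a b c d e :: real
  shows "fourth_difference h (\<lambda>x. a * x ^ 4 + b * x ^ 3 + c * x\<^sup>2 + d * x + e) x = 24 * a * h ^ 4"
  unfolding fourth_difference_def by algebra

lemma cos_series_2_polynomial:
  assumes "0 \<le> x" "x \<le> 1"
  shows "cos_series 2 x = 0 * x ^ 4 + 0 * x ^ 3 + pi\<^sup>2 * x\<^sup>2 + (- pi\<^sup>2) * x + cos_series 2 0"
  using cos_series_2_eq[OF assms] by (simp add: right_diff_distrib)

lemma cos_series_4_polynomial:
  assumes "0 \<le> x" "x \<le> 1"
  shows "cos_series 4 x = (- (pi ^ 4 / 3)) * x ^ 4 + (2 * pi ^ 4 / 3) * x ^ 3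
    + (- 2 * pi\<^sup>2 * cos_series 2 0) * x\<^sup>2 + 0 * x + cos_series 4 0"
proof -
  define q where "q = pi\<^sup>2"
  have "pi ^ 4 = q * q" by (simp add: q_def eval_nat_numeral)
  then show ?thesis
    using cos_series_4_eq[OF assms] unfolding q_def[symmetric] by (simp add: algebra_simps)
qed

text \<open>If \<open>x\<close> has distance at least \<open>\<tau>\<close> from the integers, all five nodes of the difference lie in one period
  \<open>[0, 1]\<close>, on which the series are polynomials. For \<open>p = 4\<close> the remaining constant cancels the term \<open>n = 0\<close> of
  the kernel.\<close>

lemma fourth_difference_vanishes:
  assumes "0 < \<tau>" and far: "\<And>n::int. \<tau> \<le> \<bar>x + of_int n\<bar>"
  shows "fourth_difference (\<tau> / 2) (cos_series 2) x = 0"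
    and "fourth_difference (\<tau> / 2) (cos_series 4) x = - 8 * (pi * \<tau> / 2) ^ 4"
proof -
  define y where "y = frac x"
  have y: "\<tau> \<le> y" "y \<le> 1 - \<tau>"
    using far[of "- \<lfloor>x\<rfloor>"] far[of "- \<lfloor>x\<rfloor> - 1"] frac_ge_0[of x] frac_lt_1[of x]
    by (auto simp: y_def frac_def)
  have "x = y + of_int \<lfloor>x\<rfloor>" by (simp add: y_def frac_def)
  then have shift': "cos_series p (x + t) = cos_series p (y + t)" for p t
    using cos_series_plus_int[of p "y + t" "\<lfloor>x\<rfloor>"] by (simp add: add_ac)
  have shift: "fourth_difference h (cos_series p) x = fourth_difference h (cos_series p) y" for p h
    using shift'[of p 0] shift'[of p h] shift'[of p "- h"] shift'[of p "2 * h"] shift'[of p "- (2 * h)"]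
    unfolding fourth_difference_def by simp
  have poly: "fourth_difference (\<tau> / 2) S y = 24 * a * (\<tau> / 2) ^ 4"
    if S: "\<And>x. 0 \<le> x \<Longrightarrow> x \<le> 1 \<Longrightarrow> S x = a * x ^ 4 + b * x ^ 3 + c * x\<^sup>2 + d * x + e" for S a b c d e
  proof -
    have "0 \<le> y + \<tau> / 2" "y + \<tau> / 2 \<le> 1" "0 \<le> y - \<tau> / 2" "y - \<tau> / 2 \<le> 1" "0 \<le> y" "y \<le> 1"
      "0 \<le> y + 2 * (\<tau> / 2)" "y + 2 * (\<tau> / 2) \<le> 1" "0 \<le> y - 2 * (\<tau> / 2)" "y - 2 * (\<tau> / 2) \<le> 1"
      using y assms(1) by auto
    note S[OF this(1,2)] S[OF this(3,4)] S[OF this(5,6)] S[OF this(7,8)] S[OF this(9,10)]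
    then have "fourth_difference (\<tau> / 2) S y =
        fourth_difference (\<tau> / 2) (\<lambda>x. a * x ^ 4 + b * x ^ 3 + c * x\<^sup>2 + d * x + e) y"
      unfolding fourth_difference_def by (simp only:)
    then show ?thesis
      unfolding fourth_difference_polynomial .
  qed
  show "fourth_difference (\<tau> / 2) (cos_series 2) x = 0"
    unfolding shift by (subst poly[OF cos_series_2_polynomial]) auto
  show "fourth_difference (\<tau> / 2) (cos_series 4) x = - 8 * (pi * \<tau> / 2) ^ 4"
    unfolding shift by (subst poly[OF cos_series_4_polynomial]) (auto simp: power_mult_distrib power_divide)
qed

text \<open>At \<open>0\<close> the nodes lie on both sides of an integer, so the polynomial is applied to the absolute values of
  the nodes. The values yield the masses \<open>\<pi>\<^sup>2\<tau>/4\<close> of \<open>n\<^sup>2 a(n)\<close> and \<open>\<pi>\<^sup>4\<tau>\<^sup>3/12\<close> of \<open>a(n)\<close>, where \<open>a\<close> is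
  \<open>jackson_weight \<tau>\<close>; their quotient \<open>3 / (\<pi>\<tau>)\<^sup>2\<close> is the mean of \<open>n\<^sup>2\<close> under the normalised weights.\<close>

lemma fourth_difference_at_0:
  assumes "0 < \<tau>" "\<tau> \<le> 1"
  shows "fourth_difference (\<tau> / 2) (cos_series 2) 0 = 2 * pi\<^sup>2 * \<tau>"
    and "(pi * \<tau> / 2) ^ 4 + fourth_difference (\<tau> / 2) (cos_series 4) 0 / 8 = pi ^ 4 * \<tau> ^ 3 / 12"
proof -
  have e: "fourth_difference (\<tau> / 2) (cos_series p) 0 = 6 * cos_series p 0 - 8 * cos_series p (\<tau> / 2) + 2 * cos_series p \<tau>" for p
    using cos_series_minus[of p "\<tau> / 2"] cos_series_minus[of p \<tau>] by (simp add: fourth_difference_def)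
  have i: "0 \<le> \<tau> / 2" "\<tau> / 2 \<le> 1" "0 \<le> \<tau>" "\<tau> \<le> 1"
    using assms by auto
  show "fourth_difference (\<tau> / 2) (cos_series 2) 0 = 2 * pi\<^sup>2 * \<tau>"
    unfolding e cos_series_2_polynomial[OF i(1,2)] cos_series_2_polynomial[OF i(3,4)]
    by (simp add: power2_eq_square)
  show "(pi * \<tau> / 2) ^ 4 + fourth_difference (\<tau> / 2) (cos_series 4) 0 / 8 = pi ^ 4 * \<tau> ^ 3 / 12"
    unfolding e cos_series_4_polynomial[OF i(1,2)] cos_series_4_polynomial[OF i(3,4)]
    by (simp add: power_mult_distrib power_divide add_divide_distrib diff_divide_distrib)
qed

section \<open>A lattice minorant supported in a cube\<close>

lemma ee_diff: "ee (s - t) = ee s * cnj (ee t)"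
  using ee_add[of s "- t"] by (simp add: cnj_ee)

definition lattice_box :: "nat \<Rightarrow> ('d::finite \<Rightarrow> int) set" where
  "lattice_box N = PiE UNIV (\<lambda>_. {- int N..int N})"

lemma finite_lattice_box [simp]: "finite (lattice_box N)"
  by (simp add: lattice_box_def finite_PiE)

lemma sum_lattice_box_prod:
  fixes f :: "'d::finite \<Rightarrow> int \<Rightarrow> 'a::comm_semiring_1"
  shows "(\<Sum>n\<in>lattice_box N. \<Prod>i\<in>UNIV. f i (n i)) = (\<Prod>i\<in>UNIV. \<Sum>k\<in>{- int N..int N}. f i k)"
  unfolding lattice_box_def by (subst prod_sum_PiE) auto

definition lattice_dot :: "('d::finite \<Rightarrow> int) \<Rightarrow> real ^ 'd \<Rightarrow> real" where
  "lattice_dot n y = (\<Sum>i\<in>UNIV. of_int (n i) * y $ i)"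

lemma lattice_dot_diff: "lattice_dot n (x - y) = lattice_dot n x - lattice_dot n y"
  by (simp add: lattice_dot_def right_diff_distrib sum_subtractf)

text \<open>The Selberg-type minorant: nonpositive outside the cube of radius \<open>M\<close>, while its transform is built only from
  products of the transforms of \<open>a(n)\<close> and \<open>n\<^sup>2 a(n)\<close>, where \<open>a\<close> is \<open>jackson_weight \<tau>\<close>.\<close>

definition cube_minorant :: "real \<Rightarrow> real \<Rightarrow> ('d::finite \<Rightarrow> int) \<Rightarrow> real" where
  "cube_minorant \<tau> M n = (1 - (\<Sum>i\<in>UNIV. (of_int (n i))\<^sup>2) / M\<^sup>2) * (\<Prod>i\<in>UNIV. jackson_weight \<tau> (n i))"

lemma cube_minorant_nonpos:
  fixes n :: "'d::finite \<Rightarrow> int"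
  assumes "0 < M" and n: "n \<notin> lattice_box (nat \<lfloor>M\<rfloor>)"
  shows "cube_minorant \<tau> M n \<le> 0"
proof -
  obtain i where i: "\<not> (- \<lfloor>M\<rfloor> \<le> n i \<and> n i \<le> \<lfloor>M\<rfloor>)"
    using n assms(1) by (auto simp: lattice_box_def PiE_iff)
  then have "\<lfloor>M\<rfloor> + 1 \<le> \<bar>n i\<bar>" by linarith
  then have "M \<le> of_int \<bar>n i\<bar>" by linarith
  then have "M\<^sup>2 \<le> (of_int \<bar>n i\<bar>)\<^sup>2" using assms(1) by (intro power_mono) auto
  also have "\<dots> = (of_int (n i))\<^sup>2" by simp
  also have "\<dots> \<le> (\<Sum>i\<in>UNIV. (of_int (n i))\<^sup>2)"
    by (rule member_le_sum) auto
  finally have "1 \<le> (\<Sum>i\<in>UNIV. (of_int (n i))\<^sup>2) / M\<^sup>2"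
    using assms(1) by (simp add: field_simps)
  then show ?thesis
    unfolding cube_minorant_def by (intro mult_nonpos_nonneg prod_nonneg) (auto simp: jackson_weight_nonneg)
qed

text \<open>Over boxes the sum factors into one-dimensional sums, so that multidimensional infinite sums are avoided:
  all limits below are limits along growing boxes.\<close>

lemma cube_minorant_sum_factors:
  fixes x :: "real ^ 'd"
  shows "(\<Sum>n\<in>lattice_box N. of_real (cube_minorant \<tau> M n) * ee (lattice_dot n x)) =
    (\<Prod>i\<in>UNIV. \<Sum>k\<in>{- int N..int N}. of_real (jackson_weight \<tau> k) * ee (of_int k * x $ i))
    - (\<Sum>l\<in>UNIV. \<Prod>i\<in>UNIV. \<Sum>k\<in>{- int N..int N}.
        of_real (if i = l then (of_int k)\<^sup>2 * jackson_weight \<tau> k else jackson_weight \<tau> k) * ee (of_int k * x $ i)) / of_real (M\<^sup>2)"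
proof -
  have e: "(\<Prod>i\<in>UNIV. of_real (if i = l then (of_int (n i))\<^sup>2 * jackson_weight \<tau> (n i) else jackson_weight \<tau> (n i)) * ee (of_int (n i) * x $ i))
      = of_real ((of_int (n l))\<^sup>2) * (\<Prod>i\<in>UNIV. of_real (jackson_weight \<tau> (n i)) * ee (of_int (n i) * x $ i))"
    for l and n :: "'d \<Rightarrow> int"
  proof -
    have "(\<Prod>i\<in>UNIV. of_real (if i = l then (of_int (n i))\<^sup>2 * jackson_weight \<tau> (n i) else jackson_weight \<tau> (n i)) * ee (of_int (n i) * x $ i))
      = (\<Prod>i\<in>UNIV. (if i = l then of_real ((of_int (n i))\<^sup>2) else 1) * (of_real (jackson_weight \<tau> (n i)) * ee (of_int (n i) * x $ i)))"
      by (intro prod.cong) auto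
    then show ?thesis by (simp add: prod.distrib)
  qed
  have "of_real (cube_minorant \<tau> M n) * ee (lattice_dot n x) =
      (\<Prod>i\<in>UNIV. of_real (jackson_weight \<tau> (n i)) * ee (of_int (n i) * x $ i))
      - (\<Sum>l\<in>UNIV. \<Prod>i\<in>UNIV. of_real (if i = l then (of_int (n i))\<^sup>2 * jackson_weight \<tau> (n i) else jackson_weight \<tau> (n i)) * ee (of_int (n i) * x $ i)) / of_real (M\<^sup>2)"
    for n :: "'d \<Rightarrow> int"
    unfolding e sum_distrib_right[symmetric]
    by (simp add: cube_minorant_def lattice_dot_def ee_sum prod.distrib left_diff_distrib)
  then show ?thesis
    unfolding sum_lattice_box_prod[symmetric]
    by (simp add: sum_subtractf sum_divide_distrib[symmetric] sum.swap[of _ _ "UNIV :: 'd set"])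
qed

lemma cube_minorant_sum_limit:
  fixes x :: "real ^ 'd" and \<tau> M :: real
  defines "A i \<equiv> (pi * \<tau> / 2) ^ 4 + fourth_difference (\<tau> / 2) (cos_series 4) (x $ i) / 8"
    and "B i \<equiv> fourth_difference (\<tau> / 2) (cos_series 2) (x $ i) / 8"
  shows "(\<lambda>N. \<Sum>n\<in>lattice_box N. of_real (cube_minorant \<tau> M n) * ee (lattice_dot n x)) \<longlonglongrightarrow>
    of_real ((\<Prod>i\<in>UNIV. A i) - (\<Sum>l\<in>UNIV. \<Prod>i\<in>UNIV. if i = l then B i else A i) / M\<^sup>2)"
proof -
  have *: "(\<lambda>N. \<Sum>k\<in>{- int N..int N}. of_real (if i = l then (of_int k)\<^sup>2 * jackson_weight \<tau> k else jackson_weight \<tau> k) * ee (of_int k * x $ i))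
     \<longlonglongrightarrow> of_real (if i = l then B i else A i)" for i l
    using jackson_weight_series[of \<tau> "x $ i"] square_jackson_weight_series[of \<tau> "x $ i"]
    by (cases "i = l") (simp_all add: A_def B_def)
  have "(\<lambda>N. \<Sum>n\<in>lattice_box N. of_real (cube_minorant \<tau> M n) * ee (lattice_dot n x)) \<longlonglongrightarrow>
     (\<Prod>i\<in>UNIV. of_real (A i)) - (\<Sum>l\<in>UNIV. \<Prod>i\<in>UNIV. of_real (if i = l then B i else A i)) / of_real (M\<^sup>2)"
    unfolding cube_minorant_sum_factors divide_inverse
    by (intro tendsto_diff tendsto_mult_right tendsto_sum tendsto_prod *)
      (simp only: A_def jackson_weight_series)
  then show ?thesis by simp
qed

text \<open>One coordinate in which \<open>x\<close> is far from the integers makes every product vanish, since that coordinate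
  contributes either the transform of \<open>a(n)\<close> or the one of \<open>n\<^sup>2 a(n)\<close>.\<close>

lemma cube_minorant_sum_far:
  fixes x :: "real ^ 'd"
  assumes "0 < \<tau>" and "\<And>n::int. \<tau> \<le> \<bar>x $ i + of_int n\<bar>"
  shows "(\<lambda>N. \<Sum>n\<in>lattice_box N. of_real (cube_minorant \<tau> M n) * ee (lattice_dot n x)) \<longlonglongrightarrow> 0"
proof -
  define A where "A i = (pi * \<tau> / 2) ^ 4 + fourth_difference (\<tau> / 2) (cos_series 4) (x $ i) / 8" for i
  define B where "B i = fourth_difference (\<tau> / 2) (cos_series 2) (x $ i) / 8" for i
  have "A i = 0" "B i = 0"
    using fourth_difference_vanishes[OF assms] by (simp_all add: A_def B_def)
  then have "(\<Prod>i\<in>UNIV. A i) = 0" "\<And>l. (\<Prod>i\<in>UNIV. if i = l then B i else A i) = 0"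
    by (auto intro!: prod_zero bexI[of _ i] simp del: prod_zero_iff)
  then have "(\<Prod>i\<in>UNIV. A i) - (\<Sum>l\<in>UNIV. \<Prod>i\<in>UNIV. if i = l then B i else A i) / M\<^sup>2 = 0"
    by (simp only: sum.neutral_const diff_0_right div_0)
  then show ?thesis
    using cube_minorant_sum_limit[of \<tau> M x] unfolding A_def[symmetric] B_def[symmetric]
    by (simp only: of_real_0)
qed

text \<open>The total mass of the minorant. Each of the \<open>d\<close> subtracted terms contributes the mean of \<open>n\<^sup>2\<close>,
  \<open>3 / (\<pi>\<tau>)\<^sup>2\<close>, relative to the mass of the product weight.\<close>

lemma cube_minorant_sum_at_0:
  assumes "0 < \<tau>" "\<tau> \<le> 1"
  shows "(\<lambda>N. \<Sum>n\<in>lattice_box N. complex_of_real (cube_minorant \<tau> M n) * ee (lattice_dot n (0 :: real ^ 'd))) \<longlonglongrightarrow>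
    of_real ((pi ^ 4 * \<tau> ^ 3 / 12) ^ CARD('d) * (1 - 3 * real CARD('d) / (pi * \<tau> * M)\<^sup>2))"
proof -
  define a where "a = pi ^ 4 * \<tau> ^ 3 / 12"
  have a: "(pi * \<tau> / 2) ^ 4 + fourth_difference (\<tau> / 2) (cos_series 4) 0 / 8 = a"
    "fourth_difference (\<tau> / 2) (cos_series 2) 0 / 8 = a * (3 / (pi * \<tau>)\<^sup>2)"
    using fourth_difference_at_0[OF assms] assms(1) by (simp_all add: a_def field_simps eval_nat_numeral)
  have "(\<Prod>i\<in>UNIV. if i = l then a * (3 / (pi * \<tau>)\<^sup>2) else a) = a ^ CARD('d) * (3 / (pi * \<tau>)\<^sup>2)" for l :: 'd
  proof -
    have "(\<Prod>i\<in>UNIV. if i = l then a * (3 / (pi * \<tau>)\<^sup>2) else a) = (\<Prod>i\<in>UNIV. a * (if i = l then 3 / (pi * \<tau>)\<^sup>2 else 1))"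
      by (intro prod.cong) auto
    then show ?thesis by (simp add: prod.distrib)
  qed
  then show ?thesis
    using cube_minorant_sum_limit[of \<tau> M "0 :: real ^ 'd"]
    unfolding zero_index a a_def[symmetric]
    by (simp add: right_diff_distrib power_mult_distrib mult_ac)
qed

lemma complex_norm_square_sum:
  "complex_of_real ((cmod (\<Sum>j\<in>J. z j))\<^sup>2) = (\<Sum>j\<in>J. \<Sum>k\<in>J. z j * cnj (z k))"
  unfolding complex_norm_square by (simp add: sum_product)

text \<open>Expanding the square, the terms with \<open>j \<noteq> k\<close> tend to \<open>0\<close> by separation and the diagonal ones to the mass.\<close>

lemma cube_minorant_quadratic_form_limit:
  fixes y :: "'s \<Rightarrow> real ^ 'd"
  assumes "finite J" "0 < \<tau>" "\<tau> \<le> 1"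
    and far: "\<And>j k. j \<in> J \<Longrightarrow> k \<in> J \<Longrightarrow> j \<noteq> k \<Longrightarrow> \<exists>i. \<forall>n::int. \<tau> \<le> \<bar>(y j - y k) $ i + of_int n\<bar>"
  shows "(\<lambda>N. \<Sum>n\<in>lattice_box N. cube_minorant \<tau> M n * (cmod (\<Sum>j\<in>J. c j * ee (lattice_dot n (y j))))\<^sup>2) \<longlonglongrightarrow>
    (pi ^ 4 * \<tau> ^ 3 / 12) ^ CARD('d) * (1 - 3 * real CARD('d) / (pi * \<tau> * M)\<^sup>2) * (\<Sum>j\<in>J. (cmod (c j))\<^sup>2)"
proof -
  define L where "L = (pi ^ 4 * \<tau> ^ 3 / 12) ^ CARD('d) * (1 - 3 * real CARD('d) / (pi * \<tau> * M)\<^sup>2)"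
  define \<Psi> where "\<Psi> N x = (\<Sum>n\<in>lattice_box N. of_real (cube_minorant \<tau> M n) * ee (lattice_dot n x))" for N and x :: "real ^ 'd"
  have \<Psi>: "(\<lambda>N. \<Psi> N (y j - y k)) \<longlonglongrightarrow> of_real (if k = j then L else 0)" if jk: "j \<in> J" "k \<in> J" for j k
  proof (cases "k = j")
    case True
    then show ?thesis using cube_minorant_sum_at_0[OF assms(2,3), of M, where 'd='d] by (simp add: \<Psi>_def L_def)
  next
    case False
    then obtain i where "\<And>n::int. \<tau> \<le> \<bar>(y j - y k) $ i + of_int n\<bar>" using far[of j k] jk by metis
    from cube_minorant_sum_far[OF assms(2) this] False show ?thesis by (simp add: \<Psi>_def)
  qed
  have eq: "complex_of_real (\<Sum>n\<in>lattice_box N. cube_minorant \<tau> M n * (cmod (\<Sum>j\<in>J. c j * ee (lattice_dot n (y j))))\<^sup>2)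
    = (\<Sum>j\<in>J. \<Sum>k\<in>J. c j * cnj (c k) * \<Psi> N (y j - y k))" for N
  proof -
    have "complex_of_real (cube_minorant \<tau> M n * (cmod (\<Sum>j\<in>J. c j * ee (lattice_dot n (y j))))\<^sup>2)
      = (\<Sum>j\<in>J. \<Sum>k\<in>J. c j * cnj (c k) * (of_real (cube_minorant \<tau> M n) * ee (lattice_dot n (y j - y k))))" for n
      unfolding of_real_mult complex_norm_square_sum sum_distrib_left
      by (simp add: lattice_dot_diff ee_diff mult_ac)
    then have "complex_of_real (\<Sum>n\<in>lattice_box N. cube_minorant \<tau> M n * (cmod (\<Sum>j\<in>J. c j * ee (lattice_dot n (y j))))\<^sup>2)
      = (\<Sum>n\<in>lattice_box N. \<Sum>j\<in>J. \<Sum>k\<in>J. c j * cnj (c k) * (of_real (cube_minorant \<tau> M n) * ee (lattice_dot n (y j - y k))))"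
      by (simp only: of_real_sum)
    also have "\<dots> = (\<Sum>j\<in>J. \<Sum>k\<in>J. \<Sum>n\<in>lattice_box N. c j * cnj (c k) * (of_real (cube_minorant \<tau> M n) * ee (lattice_dot n (y j - y k))))"
      by (subst sum.swap) (intro sum.cong refl sum.swap)
    finally show ?thesis by (simp only: \<Psi>_def sum_distrib_left)
  qed
  have "(\<lambda>N. \<Sum>j\<in>J. \<Sum>k\<in>J. c j * cnj (c k) * \<Psi> N (y j - y k)) \<longlonglongrightarrow>
     (\<Sum>j\<in>J. \<Sum>k\<in>J. c j * cnj (c k) * of_real (if k = j then L else 0))"
    by (intro tendsto_sum tendsto_mult tendsto_const \<Psi>)
  also have "(\<Sum>j\<in>J. \<Sum>k\<in>J. c j * cnj (c k) * of_real (if k = j then L else 0)) = (\<Sum>j\<in>J. c j * cnj (c j) * of_real L)"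
  proof (intro sum.cong refl)
    fix j assume "j \<in> J"
    have "(\<Sum>k\<in>J. c j * cnj (c k) * of_real (if k = j then L else 0)) = (\<Sum>k\<in>J. if k = j then c j * cnj (c k) * of_real L else 0)"
      by (intro sum.cong) auto
    then show "(\<Sum>k\<in>J. c j * cnj (c k) * of_real (if k = j then L else 0)) = c j * cnj (c j) * of_real L"
      using \<open>finite J\<close> \<open>j \<in> J\<close> by simp
  qed
  also have "\<dots> = complex_of_real (L * (\<Sum>j\<in>J. (cmod (c j))\<^sup>2))"
    by (simp only: complex_norm_square[symmetric] of_real_mult of_real_sum sum_distrib_left mult.commute)
  finally have "(\<lambda>N. complex_of_real (\<Sum>n\<in>lattice_box N. cube_minorant \<tau> M n * (cmod (\<Sum>j\<in>J. c j * ee (lattice_dot n (y j))))\<^sup>2))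
     \<longlonglongrightarrow> complex_of_real (L * (\<Sum>j\<in>J. (cmod (c j))\<^sup>2))"
    unfolding eq .
  then show ?thesis
    unfolding L_def using tendsto_of_real_iff by blast
qed

definition cube_weight :: "real \<Rightarrow> real \<Rightarrow> ('d::finite \<Rightarrow> int) \<Rightarrow> real" where
  "cube_weight \<tau> M n = max 0 (cube_minorant \<tau> M n)"

text \<open>Discarding the lattice points outside the cube can only increase the sum, because the minorant is nonpositive there.
  Thus the finite sum over the cube dominates the limit of the sums over boxes.\<close>

lemma cube_weight_lower_bound:
  fixes y :: "'s \<Rightarrow> real ^ 'd"
  assumes "finite J" "0 < \<tau>" "\<tau> \<le> 1" "0 < M"
    and far: "\<And>j k. j \<in> J \<Longrightarrow> k \<in> J \<Longrightarrow> j \<noteq> k \<Longrightarrow> \<exists>i. \<forall>n::int. \<tau> \<le> \<bar>(y j - y k) $ i + of_int n\<bar>"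
  shows "(pi ^ 4 * \<tau> ^ 3 / 12) ^ CARD('d) * (1 - 3 * real CARD('d) / (pi * \<tau> * M)\<^sup>2) * (\<Sum>j\<in>J. (cmod (c j))\<^sup>2) \<le>
    (\<Sum>n\<in>lattice_box (nat \<lfloor>M\<rfloor>). cube_weight \<tau> M n * (cmod (\<Sum>j\<in>J. c j * ee (lattice_dot n (y j))))\<^sup>2)"
proof (rule LIMSEQ_le_const2[OF cube_minorant_quadratic_form_limit[OF assms(1-3) far]], assumption+, intro exI allI impI)
  fix N :: nat
  define S where "S = (lattice_box (nat \<lfloor>M\<rfloor>) :: ('d \<Rightarrow> int) set)"
  define Q where "Q n = (cmod (\<Sum>j\<in>J. c j * ee (lattice_dot n (y j))))\<^sup>2" for n
  have "(\<Sum>n\<in>lattice_box N. cube_minorant \<tau> M n * Q n) \<le> (\<Sum>n\<in>lattice_box N. if n \<in> S then cube_weight \<tau> M n * Q n else 0)"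
  proof (intro sum_mono)
    fix n :: "'d \<Rightarrow> int"
    have "0 \<le> Q n" by (simp add: Q_def)
    moreover have "cube_minorant \<tau> M n \<le> cube_weight \<tau> M n" by (simp add: cube_weight_def)
    moreover have "cube_minorant \<tau> M n \<le> 0" if "n \<notin> S"
      using cube_minorant_nonpos[OF assms(4)] that by (simp add: S_def)
    ultimately show "cube_minorant \<tau> M n * Q n \<le> (if n \<in> S then cube_weight \<tau> M n * Q n else 0)"
      by (simp add: mult_right_mono mult_nonpos_nonneg)
  qed
  also have "\<dots> = (\<Sum>n\<in>lattice_box N \<inter> S. cube_weight \<tau> M n * Q n)"
    by (simp add: sum.inter_restrict)
  also have "\<dots> \<le> (\<Sum>n\<in>S. cube_weight \<tau> M n * Q n)"
    by (rule sum_mono2) (auto simp: S_def Q_def cube_weight_def)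
  finally show "(\<Sum>n\<in>lattice_box N. cube_minorant \<tau> M n * (cmod (\<Sum>j\<in>J. c j * ee (lattice_dot n (y j))))\<^sup>2) \<le>
     (\<Sum>n\<in>lattice_box (nat \<lfloor>M\<rfloor>). cube_weight \<tau> M n * (cmod (\<Sum>j\<in>J. c j * ee (lattice_dot n (y j))))\<^sup>2)"
    by (simp add: S_def Q_def)
qed

lemma cube_weight_total:
  assumes "0 < \<tau>" "\<tau> \<le> 1" "0 < M"
  shows "(\<Sum>n\<in>lattice_box K. cube_weight \<tau> M (n :: 'd::finite \<Rightarrow> int)) \<le> (pi ^ 4 * \<tau> ^ 3 / 12) ^ CARD('d)"
proof -
  have "(\<Sum>n\<in>lattice_box K. cube_weight \<tau> M (n :: 'd \<Rightarrow> int)) \<le> (\<Sum>n\<in>lattice_box K. \<Prod>i\<in>UNIV. jackson_weight \<tau> (n (i::'d)))"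
  proof (intro sum_mono)
    fix n :: "'d \<Rightarrow> int"
    have p: "0 \<le> (\<Prod>i\<in>UNIV. jackson_weight \<tau> (n i))" by (intro prod_nonneg) (auto simp: jackson_weight_nonneg)
    have "0 \<le> (\<Sum>i\<in>UNIV. (of_int (n i))\<^sup>2) / M\<^sup>2" by (intro divide_nonneg_nonneg sum_nonneg) auto
    then have "cube_minorant \<tau> M n \<le> 1 * (\<Prod>i\<in>UNIV. jackson_weight \<tau> (n i))"
      unfolding cube_minorant_def by (intro mult_right_mono p) auto
    then show "cube_weight \<tau> M n \<le> (\<Prod>i\<in>UNIV. jackson_weight \<tau> (n i))"
      using p by (simp add: cube_weight_def)
  qed
  also have "\<dots> = (\<Sum>k\<in>{- int K..int K}. jackson_weight \<tau> k) ^ CARD('d)"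
    by (subst sum_lattice_box_prod) simp
  also have "\<dots> \<le> (pi ^ 4 * \<tau> ^ 3 / 12) ^ CARD('d)"
  proof (intro power_mono sum_nonneg jackson_weight_nonneg)
    have "(\<lambda>N. complex_of_real (\<Sum>k\<in>{- int N..int N}. jackson_weight \<tau> k)) \<longlonglongrightarrow> of_real (pi ^ 4 * \<tau> ^ 3 / 12)"
      using jackson_weight_series[of \<tau> 0] fourth_difference_at_0(2)[OF assms(1,2)] by simp
    then have "(\<lambda>N. (\<Sum>k\<in>{- int N..int N}. jackson_weight \<tau> k)) \<longlonglongrightarrow> pi ^ 4 * \<tau> ^ 3 / 12"
      using tendsto_of_real_iff by blast
    then show "(\<Sum>k\<in>{- int K..int K}. jackson_weight \<tau> k) \<le> pi ^ 4 * \<tau> ^ 3 / 12"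
    proof (rule LIMSEQ_le_const, intro exI[of _ K] allI impI)
      fix N assume "K \<le> N"
      then show "(\<Sum>k\<in>{- int K..int K}. jackson_weight \<tau> k) \<le> (\<Sum>k\<in>{- int N..int N}. jackson_weight \<tau> k)"
        by (intro sum_mono2) (auto simp: jackson_weight_nonneg)
    qed
  qed
  finally show ?thesis .
qed

section \<open>Exponential sums with controlled spectrum\<close>

text \<open>The constant \<open>C\<close> bounds the \<open>\<ell>\<^sup>1\<close> norm of the coefficients, the norm that is submultiplicative under products of
  functions (convolution of the coefficients).\<close>

definition exp_sum_on :: "(real ^ 'd) set \<Rightarrow> real \<Rightarrow> (real ^ 'd \<Rightarrow> complex) \<Rightarrow> bool" where
  "exp_sum_on \<Lambda> C f \<longleftrightarrow> (\<exists>F \<alpha>. finite F \<and> F \<subseteq> \<Lambda> \<and> (\<Sum>\<omega>\<in>F. cmod (\<alpha> \<omega>)) \<le> C \<and>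
     (\<forall>y. f y = (\<Sum>\<omega>\<in>F. \<alpha> \<omega> * ee (- (\<omega> \<bullet> y)))))"

lemma exp_sum_on_mono:
  assumes "exp_sum_on A C f" "A \<subseteq> B" "C \<le> D"
  shows "exp_sum_on B D f"
proof -
  obtain F \<alpha> where "finite F" "F \<subseteq> A" "(\<Sum>\<omega>\<in>F. cmod (\<alpha> \<omega>)) \<le> C"
    "\<forall>y. f y = (\<Sum>\<omega>\<in>F. \<alpha> \<omega> * ee (- (\<omega> \<bullet> y)))"
    using assms(1) unfolding exp_sum_on_def by blast
  moreover have "F \<subseteq> B" "(\<Sum>\<omega>\<in>F. cmod (\<alpha> \<omega>)) \<le> D" using calculation assms by auto
  ultimately show ?thesis unfolding exp_sum_on_def by blast
qed

text \<open>Frequencies may be repeated: merging equal ones does not increase the \<open>\<ell>\<^sup>1\<close> norm.\<close>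

lemma exp_sum_on_indexed:
  assumes "finite I" "\<And>i. i \<in> I \<Longrightarrow> w i \<in> \<Lambda>" "(\<Sum>i\<in>I. cmod (a i)) \<le> C"
    "\<And>y. f y = (\<Sum>i\<in>I. a i * ee (- (w i \<bullet> y)))"
  shows "exp_sum_on \<Lambda> C f"
  unfolding exp_sum_on_def
proof (intro exI conjI allI)
  define \<alpha> where "\<alpha> \<omega> = (\<Sum>i\<in>{i\<in>I. w i = \<omega>}. a i)" for \<omega>
  show "finite (w ` I)" "w ` I \<subseteq> \<Lambda>" using assms by auto
  have "(\<Sum>\<omega>\<in>w ` I. cmod (\<alpha> \<omega>)) \<le> (\<Sum>\<omega>\<in>w ` I. \<Sum>i\<in>{i\<in>I. w i = \<omega>}. cmod (a i))"
    unfolding \<alpha>_def by (intro sum_mono norm_sum)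
  also have "\<dots> = (\<Sum>i\<in>I. cmod (a i))" by (rule sum.image_gen[symmetric]) fact
  finally show "(\<Sum>\<omega>\<in>w ` I. cmod (\<alpha> \<omega>)) \<le> C" using assms(3) by linarith
  fix y
  have "f y = (\<Sum>\<omega>\<in>w ` I. \<Sum>i\<in>{i\<in>I. w i = \<omega>}. a i * ee (- (w i \<bullet> y)))"
    unfolding assms(4) by (rule sum.image_gen) fact
  also have "\<dots> = (\<Sum>\<omega>\<in>w ` I. \<alpha> \<omega> * ee (- (\<omega> \<bullet> y)))"
    unfolding \<alpha>_def sum_distrib_right by (intro sum.cong) auto
  finally show "f y = (\<Sum>\<omega>\<in>w ` I. \<alpha> \<omega> * ee (- (\<omega> \<bullet> y)))" .
qed

lemma exp_sum_on_times:
  assumes "exp_sum_on A C f" "exp_sum_on B D g" "0 \<le> C" and AB: "\<And>a b. a \<in> A \<Longrightarrow> b \<in> B \<Longrightarrow> a + b \<in> \<Lambda>"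
  shows "exp_sum_on \<Lambda> (C * D) (\<lambda>y. f y * g y)"
proof -
  obtain F \<alpha> where F: "finite F" "F \<subseteq> A" "(\<Sum>\<omega>\<in>F. cmod (\<alpha> \<omega>)) \<le> C"
    "\<And>y. f y = (\<Sum>\<omega>\<in>F. \<alpha> \<omega> * ee (- (\<omega> \<bullet> y)))"
    using assms(1) unfolding exp_sum_on_def by blast
  obtain G \<beta> where G: "finite G" "G \<subseteq> B" "(\<Sum>\<omega>\<in>G. cmod (\<beta> \<omega>)) \<le> D"
    "\<And>y. g y = (\<Sum>\<omega>\<in>G. \<beta> \<omega> * ee (- (\<omega> \<bullet> y)))"
    using assms(2) unfolding exp_sum_on_def by blast
  show ?thesis
  proof (rule exp_sum_on_indexed[where I="F \<times> G" and w="\<lambda>(a, b). a + b" and a="\<lambda>(a, b). \<alpha> a * \<beta> b"])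
    show "finite (F \<times> G)" using F G by simp
    show "(case p of (a, b) \<Rightarrow> a + b) \<in> \<Lambda>" if "p \<in> F \<times> G" for p using that F(2) G(2) AB by auto
    have "(\<Sum>p\<in>F \<times> G. cmod (case p of (a, b) \<Rightarrow> \<alpha> a * \<beta> b)) = (\<Sum>\<omega>\<in>F. cmod (\<alpha> \<omega>)) * (\<Sum>\<omega>\<in>G. cmod (\<beta> \<omega>))"
      by (simp add: sum_product sum.cartesian_product norm_mult case_prod_unfold)
    also have "\<dots> \<le> C * D" using F(3) G(3) assms(3) by (intro mult_mono sum_nonneg) auto
    finally show "(\<Sum>p\<in>F \<times> G. cmod (case p of (a, b) \<Rightarrow> \<alpha> a * \<beta> b)) \<le> C * D" .
    show "f y * g y = (\<Sum>p\<in>F \<times> G. (case p of (a, b) \<Rightarrow> \<alpha> a * \<beta> b) * ee (- ((case p of (a, b) \<Rightarrow> a + b) \<bullet> y)))" for y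
      unfolding F(4) G(4) sum_product sum.cartesian_product
      by (intro sum.cong refl) (auto simp: inner_add_left mult_ac simp flip: ee_add)
  qed
qed

lemma infnorm_le_cart_iff: "infnorm (x :: real ^ 'd) \<le> r \<longleftrightarrow> (\<forall>i. \<bar>x $ i\<bar> \<le> r)"
proof
  show "\<forall>i. \<bar>x $ i\<bar> \<le> r" if "infnorm x \<le> r"
    using that component_le_infnorm_cart[of x] order_trans by blast
  show "infnorm x \<le> r" if "\<forall>i. \<bar>x $ i\<bar> \<le> r"
    unfolding infnorm_cart by (intro cSup_least) (use that in auto)
qed

lemma Qcube_plus: "a \<in> Qcube R \<Longrightarrow> b \<in> Qcube S \<Longrightarrow> a + b \<in> Qcube (R + S)"
  using infnorm_triangle[of a b] by (simp add: Qcube_def)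

lemma exp_sum_on_prod:
  fixes f :: "'a \<Rightarrow> real ^ 'd \<Rightarrow> complex"
  assumes "finite I" and \<Lambda>: "0 \<in> \<Lambda>" "\<And>a b. a \<in> \<Lambda> \<Longrightarrow> b \<in> \<Lambda> \<Longrightarrow> a + b \<in> \<Lambda>"
    and f: "\<And>i. i \<in> I \<Longrightarrow> exp_sum_on (\<Lambda> \<inter> Qcube R) (C i) (f i)" and C: "\<And>i. i \<in> I \<Longrightarrow> 0 \<le> C i"
  shows "exp_sum_on (\<Lambda> \<inter> Qcube (real (card I) * R)) (\<Prod>i\<in>I. C i) (\<lambda>y. \<Prod>i\<in>I. f i y)"
  using assms(1) f C
proof (induction I rule: finite_induct)
  case empty
  show ?case
    by (rule exp_sum_on_indexed[where I="{0::nat}" and w="\<lambda>_. 0" and a="\<lambda>_. 1"])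
      (auto simp: \<Lambda> Qcube_def infnorm_0)
next
  case (insert i I)
  have "exp_sum_on (\<Lambda> \<inter> Qcube (R + real (card I) * R)) (C i * (\<Prod>i\<in>I. C i)) (\<lambda>y. f i y * (\<Prod>i\<in>I. f i y))"
    using insert by (intro exp_sum_on_times[where A="\<Lambda> \<inter> Qcube R" and B="\<Lambda> \<inter> Qcube (real (card I) * R)"])
      (auto intro: \<Lambda> Qcube_plus)
  then show ?case using insert(1,2) by (simp add: algebra_simps)
qed

lemma exp_sum_on_scale:
  fixes f :: "real ^ 'd \<Rightarrow> complex"
  assumes "exp_sum_on \<Lambda> C f" and "\<And>\<omega>. \<omega> \<in> \<Lambda> \<Longrightarrow> t *\<^sub>R \<omega> \<in> \<Lambda>'"
  shows "exp_sum_on \<Lambda>' C (\<lambda>y. f (t *\<^sub>R y))"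
proof -
  obtain F \<alpha> where F: "finite F" "F \<subseteq> \<Lambda>" "(\<Sum>\<omega>\<in>F. cmod (\<alpha> \<omega>)) \<le> C"
    "\<And>y. f y = (\<Sum>\<omega>\<in>F. \<alpha> \<omega> * ee (- (\<omega> \<bullet> y)))"
    using assms(1) unfolding exp_sum_on_def by blast
  then show ?thesis
    using assms(2) by (intro exp_sum_on_indexed[where I=F and w="\<lambda>\<omega>. t *\<^sub>R \<omega>" and a=\<alpha>]) auto
qed

section \<open>Interpolation at separated points\<close>

lemma Gram_quadratic_form:
  fixes y :: "'s \<Rightarrow> real ^ 'd" and w :: "('d \<Rightarrow> int) \<Rightarrow> real" and J :: "'s set"
  defines "P c n \<equiv> (\<Sum>j\<in>J. c j * ee (lattice_dot n (y j)))"
  shows "(\<Sum>l\<in>J. cnj (c l) * (\<Sum>n\<in>S. of_real (w n) * P c n * ee (- lattice_dot n (y l)))) =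
    of_real (\<Sum>n\<in>S. w n * (cmod (P c n))\<^sup>2)"
proof -
  have "(\<Sum>l\<in>J. cnj (c l) * (\<Sum>n\<in>S. of_real (w n) * P c n * ee (- lattice_dot n (y l))))
      = (\<Sum>n\<in>S. \<Sum>l\<in>J. cnj (c l) * (of_real (w n) * P c n * ee (- lattice_dot n (y l))))"
    unfolding sum_distrib_left by (rule sum.swap)
  also have "\<dots> = (\<Sum>n\<in>S. of_real (w n) * (P c n * cnj (P c n)))"
  proof (intro sum.cong refl)
    fix n
    have "cnj (P c n) = (\<Sum>l\<in>J. cnj (c l) * ee (- lattice_dot n (y l)))"
      by (simp add: P_def cnj_ee)
    then show "(\<Sum>l\<in>J. cnj (c l) * (of_real (w n) * P c n * ee (- lattice_dot n (y l)))) = of_real (w n) * (P c n * cnj (P c n))"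
      by (simp add: sum_distrib_left mult_ac)
  qed
  also have "\<dots> = of_real (\<Sum>n\<in>S. w n * (cmod (P c n))\<^sup>2)"
    by (simp only: complex_norm_square[symmetric] of_real_sum of_real_mult)
  finally show ?thesis .
qed

text \<open>The Gram matrix of the nodes in \<open>J\<close> is positive definite, hence injective, hence surjective. To stay within one
  vector type, the map is extended by the identity on the coordinates outside \<open>J\<close>.\<close>

lemma Gram_system_solvable:
  fixes y :: "'s::finite \<Rightarrow> real ^ 'd" and w :: "('d \<Rightarrow> int) \<Rightarrow> real"
  assumes "k \<in> J" "finite S" "0 < \<kappa>"
    and lower: "\<And>c. \<kappa> * (\<Sum>j\<in>J. (cmod (c j))\<^sup>2) \<le> (\<Sum>n\<in>S. w n * (cmod (\<Sum>j\<in>J. c j * ee (lattice_dot n (y j))))\<^sup>2)"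
  obtains c where "\<And>l. l \<in> J \<Longrightarrow>
    (\<Sum>n\<in>S. of_real (w n) * (\<Sum>j\<in>J. c j * ee (lattice_dot n (y j))) * ee (- lattice_dot n (y l))) = (if l = k then 1 else 0)"
proof -
  define P where "P c n = (\<Sum>j\<in>J. c $ j * ee (lattice_dot n (y j)))" for c :: "complex ^ 's" and n
  define G where "G c l = (\<Sum>n\<in>S. of_real (w n) * P c n * ee (- lattice_dot n (y l)))" for c l
  define T where "T c = (\<chi> l. if l \<in> J then G c l else c $ l)" for c
  have lin: "linear T"
  proof (rule linearI)
    fix a b :: "complex ^ 's" and r :: real
    have "P (a + b) n = P a n + P b n" "P (r *\<^sub>R a) n = r *\<^sub>R P a n" for n
      unfolding P_def by (simp_all add: sum.distrib distrib_right scaleR_sum_right)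
    then have "G (a + b) l = G a l + G b l" "G (r *\<^sub>R a) l = r *\<^sub>R G a l" for l
      unfolding G_def by (simp_all add: sum.distrib distrib_left distrib_right scaleR_sum_right)
    then show "T (a + b) = T a + T b" "T (r *\<^sub>R a) = r *\<^sub>R T a"
      by (auto simp: T_def vec_eq_iff)
  qed
  have quad: "(\<Sum>l\<in>J. cnj (c $ l) * G c l) = of_real (\<Sum>n\<in>S. w n * (cmod (P c n))\<^sup>2)" for c
    unfolding G_def P_def by (rule Gram_quadratic_form)
  have "inj T"
    unfolding linear_injective_0[OF lin]
  proof (intro allI impI)
    fix c assume "T c = 0"
    then have z: "\<And>l. l \<in> J \<Longrightarrow> G c l = 0" "\<And>l. l \<notin> J \<Longrightarrow> c $ l = 0"
      by (auto simp: T_def vec_eq_iff split: if_splits)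
    have "complex_of_real (\<Sum>n\<in>S. w n * (cmod (P c n))\<^sup>2) = 0"
      unfolding quad[symmetric] using z(1) by simp
    then have "(\<Sum>n\<in>S. w n * (cmod (P c n))\<^sup>2) = 0" by (simp only: of_real_eq_0_iff)
    then have "\<kappa> * (\<Sum>j\<in>J. (cmod (c $ j))\<^sup>2) \<le> 0"
      using lower[of "\<lambda>j. c $ j"] by (simp add: P_def)
    then have "(\<Sum>j\<in>J. (cmod (c $ j))\<^sup>2) \<le> 0" using \<open>0 < \<kappa>\<close> by (simp add: mult_le_0_iff)
    then have "(\<Sum>j\<in>J. (cmod (c $ j))\<^sup>2) = 0" by (intro antisym sum_nonneg) auto
    then have "\<And>j. j \<in> J \<Longrightarrow> c $ j = 0" by (subst (asm) sum_nonneg_eq_0_iff) auto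
    with z(2) show "c = 0" by (auto simp: vec_eq_iff)
  qed
  then have "surj T" by (rule linear_inj_imp_surj[OF lin])
  then obtain c where c: "T c = axis k 1" by (metis surjD)
  have "G c l = (if l = k then 1 else 0)" if "l \<in> J" for l
    using arg_cong[OF c, of "\<lambda>v. v $ l"] that by (simp add: T_def axis_def)
  then show ?thesis using that[of "\<lambda>j. c $ j"] by (simp add: G_def P_def)
qed

text \<open>The solution of the Gram system with right-hand side \<open>\<delta>\<^sub>j\<^sub>k\<close> gives the coefficients \<open>w(n) P(n)\<close>, where \<open>P\<close> is the
  exponential polynomial of the solution. Their energy \<open>E = \<Sum> w |P|\<^sup>2\<close> equals the \<open>k\<close>-th component of the solution,
  so the lower bound for the quadratic form bounds \<open>E\<close> by its reciprocal; the Cauchy-Schwarz inequality with the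
  total weight then bounds the \<open>\<ell>\<^sup>1\<close> norm.\<close>

lemma separated_interpolation:
  fixes y :: "'s::finite \<Rightarrow> real ^ 'd"
  assumes "0 < \<tau>" "\<tau> \<le> 1" "0 < M" "k \<in> J"
    and far: "\<And>j k. j \<in> J \<Longrightarrow> k \<in> J \<Longrightarrow> j \<noteq> k \<Longrightarrow> \<exists>i. \<forall>n::int. \<tau> \<le> \<bar>(y j - y k) $ i + of_int n\<bar>"
    and pos: "0 < 1 - 3 * real CARD('d) / (pi * \<tau> * M)\<^sup>2"
  shows "\<exists>f. exp_sum_on (int_vecs \<inter> Qcube M) (1 / sqrt (1 - 3 * real CARD('d) / (pi * \<tau> * M)\<^sup>2)) f \<and>
    (\<forall>j\<in>J. f (y j) = (if j = k then 1 else 0))"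
proof -
  define \<rho> where "\<rho> = 1 - 3 * real CARD('d) / (pi * \<tau> * M)\<^sup>2"
  define W where "W = (pi ^ 4 * \<tau> ^ 3 / 12) ^ CARD('d)"
  define S where "S = (lattice_box (nat \<lfloor>M\<rfloor>) :: ('d \<Rightarrow> int) set)"
  define w where "w n = cube_weight \<tau> M n" for n :: "'d \<Rightarrow> int"
  have W: "0 < W" using assms(1) by (simp add: W_def)
  have \<kappa>: "0 < W * \<rho>" using W pos by (simp add: \<rho>_def)
  have w0: "0 \<le> w n" for n by (simp add: w_def cube_weight_def)
  have lower: "W * \<rho> * (\<Sum>j\<in>J. (cmod (c j))\<^sup>2) \<le> (\<Sum>n\<in>S. w n * (cmod (\<Sum>j\<in>J. c j * ee (lattice_dot n (y j))))\<^sup>2)" for c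
    using cube_weight_lower_bound[OF _ assms(1-3) far, where c=c] by (simp add: W_def \<rho>_def S_def w_def)
  have total: "(\<Sum>n\<in>S. w n) \<le> W"
    unfolding S_def w_def W_def by (rule cube_weight_total[OF assms(1-3)])
  obtain c where c: "\<And>l. l \<in> J \<Longrightarrow>
      (\<Sum>n\<in>S. of_real (w n) * (\<Sum>j\<in>J. c j * ee (lattice_dot n (y j))) * ee (- lattice_dot n (y l))) = (if l = k then 1 else 0)"
    using Gram_system_solvable[OF \<open>k \<in> J\<close> _ \<kappa> lower] by (auto simp: S_def)
  define P where "P n = (\<Sum>j\<in>J. c j * ee (lattice_dot n (y j)))" for n
  define E where "E = (\<Sum>n\<in>S. w n * (cmod (P n))\<^sup>2)"
  have E0: "0 \<le> E" unfolding E_def by (intro sum_nonneg) (simp add: w0)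
  have "cnj (c k) = (\<Sum>l\<in>J. cnj (c l) * (if l = k then 1 else 0))"
    using \<open>k \<in> J\<close> by (simp add: if_distrib[of "\<lambda>z. _ * z"] cong: if_cong)
  also have "\<dots> = (\<Sum>l\<in>J. cnj (c l) * (\<Sum>n\<in>S. of_real (w n) * P n * ee (- lattice_dot n (y l))))"
    by (intro sum.cong refl) (simp only: c P_def)
  also have "\<dots> = of_real E" unfolding P_def E_def by (rule Gram_quadratic_form)
  finally have "cmod (c k) = E" using E0 by (metis complex_mod_cnj norm_of_real abs_of_nonneg)
  then have "W * \<rho> * E\<^sup>2 \<le> W * \<rho> * (\<Sum>j\<in>J. (cmod (c j))\<^sup>2)"
    using \<open>k \<in> J\<close> \<kappa> by (intro mult_left_mono) (auto intro!: member_le_sum[of k J "\<lambda>j. (cmod (c j))\<^sup>2", simplified])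
  also have "\<dots> \<le> E" using lower[of c] by (simp add: E_def P_def)
  finally have "W * \<rho> * E * E \<le> 1 * E" by (simp add: power2_eq_square mult_ac)
  then have WE: "W * E \<le> 1 / \<rho>"
    using E0 pos[folded \<rho>_def] by (cases "E = 0") (auto simp: field_simps)
  have "(\<Sum>n\<in>S. cmod (of_real (w n) * P n))\<^sup>2 = (\<Sum>n\<in>S. sqrt (w n) * (sqrt (w n) * cmod (P n)))\<^sup>2"
    using w0 by (simp add: norm_mult mult.assoc[symmetric])
  also have "\<dots> \<le> (\<Sum>n\<in>S. (sqrt (w n))\<^sup>2) * (\<Sum>n\<in>S. (sqrt (w n) * cmod (P n))\<^sup>2)"
    by (rule Cauchy_Schwarz_ineq_sum)
  also have "\<dots> = (\<Sum>n\<in>S. w n) * E"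
    using w0 by (simp add: power_mult_distrib E_def)
  also have "\<dots> \<le> W * E" by (intro mult_right_mono total E0)
  also have "\<dots> \<le> 1 / \<rho>" by fact
  finally have "(\<Sum>n\<in>S. cmod (of_real (w n) * P n)) \<le> sqrt (1 / \<rho>)"
    by (rule real_le_rsqrt)
  then have norm: "(\<Sum>n\<in>S. cmod (of_real (w n) * P n)) \<le> 1 / sqrt \<rho>"
    by (simp add: real_sqrt_divide)
  define f where "f z = (\<Sum>n\<in>S. of_real (w n) * P n * ee (- lattice_dot n z))" for z :: "real ^ 'd"
  have "exp_sum_on (int_vecs \<inter> Qcube M) (1 / sqrt \<rho>) f"
  proof (rule exp_sum_on_indexed[where I=S and w="\<lambda>n. \<chi> i. of_int (n i)" and a="\<lambda>n. of_real (w n) * P n"])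
    show "finite S" by (simp add: S_def)
    fix n assume "n \<in> S"
    then have "\<bar>n i\<bar> \<le> \<lfloor>M\<rfloor>" for i
      using assms(3) by (auto simp: S_def lattice_box_def PiE_iff abs_le_iff minus_le_iff)
    then have "\<bar>of_int (n i)\<bar> \<le> M" for i by (metis le_floor_iff of_int_abs)
    then have "infnorm (\<chi> i. real_of_int (n i)) \<le> M"
      by (simp add: infnorm_le_cart_iff)
    then show "(\<chi> i. of_int (n i)) \<in> int_vecs \<inter> Qcube M"
      by (simp add: int_vecs_def Qcube_def)
  next
    show "f z = (\<Sum>n\<in>S. of_real (w n) * P n * ee (- ((\<chi> i. of_int (n i)) \<bullet> z)))" for z
      by (simp add: f_def lattice_dot_def inner_vec_def)
  qed (rule norm)
  moreover have "f (y j) = (if j = k then 1 else 0)" if "j \<in> J" for j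
    using c[OF that] by (simp add: f_def P_def)
  ultimately show ?thesis unfolding \<rho>_def by blast
qed

section \<open>Removing one nearby point\<close>

lemma jordan_inequality:
  assumes "0 \<le> \<theta>" "\<theta> \<le> 1 / 2"
  shows "2 * \<theta> \<le> sin (pi * \<theta>)"
proof -
  have "convex_on {0..pi / 2} (\<lambda>x. - sin x)"
  proof (rule f''_ge0_imp_convex)
    show "((\<lambda>x. - sin x) has_real_derivative - cos x) (at x)" for x
      by (auto intro!: derivative_eq_intros)
    show "((\<lambda>x. - cos x) has_real_derivative sin x) (at x)" for x
      by (auto intro!: derivative_eq_intros)
  qed (auto intro: sin_ge_zero)
  moreover have "pi * \<theta> \<in> {0..pi / 2}"
    using assms mult_left_mono[of \<theta> "1/2" pi] by auto
  ultimately have "- sin (pi * \<theta>) \<le> (- sin (pi / 2) - - sin 0) / (pi / 2 - 0) * (pi * \<theta> - 0) + - sin 0"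
    by (intro convex_onD_Icc')
  then show ?thesis by (simp add: field_simps)
qed

lemma cmod_one_minus_ee: "cmod (1 - ee t) = 2 * \<bar>sin (pi * t)\<bar>"
proof -
  have c: "cos (2 * pi * t) = 1 - 2 * (sin (pi * t))\<^sup>2"
    using cos_double_sin[of "pi * t"] by (simp add: mult_ac)
  have "(cmod (1 - ee t))\<^sup>2 = 2 - 2 * cos (2 * pi * t)"
    using sin_cos_squared_add[of "2 * pi * t"]
    by (simp add: cmod_power2 ee_def power2_diff)
  also have "\<dots> = (2 * \<bar>sin (pi * t)\<bar>)\<^sup>2"
    unfolding c by (simp add: power_mult_distrib)
  finally show ?thesis by (rule power2_eq_imp_eq) auto
qed

text \<open>The ideal multiple would be \<open>M\<close> for small \<open>r\<close> and \<open>1 / (2r)\<close> otherwise; the choice is its integer part.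
  In the first case \<open>M \<ge> 4\<close> gives at least \<open>3/4\<close> of the ideal value. In the second \<open>r \<le> 1/4\<close> keeps \<open>t r\<close> in
  \<open>[1/4, 1/2]\<close>, where the sine is at least \<open>1 / \<surd>2\<close>.\<close>

lemma rounded_frequency:
  fixes r M :: real
  assumes "0 < r" "r \<le> 1 / 4" "4 \<le> M"
  obtains t :: int where "0 \<le> t" "of_int t \<le> M"
    "0 < sin (pi * (of_int t * r))"
    "1 / sin (pi * (of_int t * r)) \<le> sqrt 2 * (if r \<le> 1 / (2 * M) then 1 / (2 * M * r) else 1)"
proof (cases "r \<le> 1 / (2 * M)")
  case True
  define t where "t = \<lfloor>M\<rfloor>"
  have t: "of_int t \<le> M" "M - 1 < of_int t" unfolding t_def by linarith+
  then have t34: "3 / 4 * M \<le> of_int t" using assms(3) by linarith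
  have Mr: "M * r \<le> 1 / 2" using True assms by (simp add: field_simps)
  have "of_int t * r \<le> M * r" using t assms by (intro mult_right_mono) auto
  then have "of_int t * r \<le> 1 / 2" using Mr by linarith
  moreover have "0 \<le> of_int t * r" using t34 assms by (intro mult_nonneg_nonneg) auto
  ultimately have "2 * (of_int t * r) \<le> sin (pi * (of_int t * r))"
    by (intro jordan_inequality)
  moreover have "3 / 4 * M * r \<le> of_int t * r" using t34 assms by (intro mult_right_mono) auto
  ultimately have s: "3 / 2 * (M * r) \<le> sin (pi * (of_int t * r))" by simp
  have p: "0 < M * r" using assms by simp
  have "1 / sin (pi * (of_int t * r)) \<le> 1 / (3 / 2 * (M * r))"
    using s p by (intro divide_left_mono) auto
  also have "\<dots> = (4 / 3) * (1 / (2 * M * r))" using p by (simp add: field_simps)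
  also have "\<dots> \<le> sqrt 2 * (1 / (2 * M * r))"
  proof (rule mult_right_mono)
    show "4 / 3 \<le> sqrt 2" by (rule real_le_rsqrt) (simp add: power2_eq_square)
  qed (use p in auto)
  finally show ?thesis using True t s p assms(3) by (intro that[of t]) auto
next
  case False
  define t where "t = \<lfloor>1 / (2 * r)\<rfloor>"
  have t: "of_int t \<le> 1 / (2 * r)" "1 / (2 * r) < of_int t + 1" unfolding t_def by linarith+
  have "1 / (2 * r) < M" using False assms by (simp add: field_simps)
  have tr: "of_int t * r \<le> 1 / 2" "1 / 2 < of_int t * r + r"
    using t assms(1) by (simp_all add: field_simps)
  have "sin (pi / 4) \<le> sin (pi * (of_int t * r))"
    using tr assms mult_left_mono[of "of_int t * r" "1/2" pi] mult_left_mono[of "1/4" "of_int t * r" pi]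
    by (intro sin_monotone_2pi_le) auto
  then have s: "sqrt 2 / 2 \<le> sin (pi * (of_int t * r))" by (simp add: sin_45)
  then have "1 / sin (pi * (of_int t * r)) \<le> 1 / (sqrt 2 / 2)"
    using less_le_trans[of 0 "sqrt 2 / 2"] by (intro divide_left_mono mult_pos_pos) auto
  also have "\<dots> = sqrt 2" by (simp add: real_div_sqrt)
  finally have "1 / sin (pi * (of_int t * r)) \<le> sqrt 2" .
  moreover have "0 < sin (pi * (of_int t * r))" using s less_le_trans[of 0 "sqrt 2 / 2"] by simp
  moreover have "0 \<le> t" using assms by (simp add: t_def)
  ultimately show ?thesis using False t \<open>1 / (2 * r) < M\<close> by (intro that[of t]) auto
qed

text \<open>The shift by the lattice vector \<open>n\<close> selects a representative of \<open>b - a\<close> on the torus. Integer frequencies do not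
  see the shift.\<close>

lemma lagrange_factor:
  fixes a b n :: "real ^ 'd"
  assumes n: "n \<in> int_vecs" and r: "r = l1norm (b - a + n)" "0 < r" "r \<le> 1 / 4" and "4 \<le> M"
  obtains L where "exp_sum_on (int_vecs \<inter> Qcube M) (sqrt 2 * (if r \<le> 1 / (2 * M) then 1 / (2 * M * r) else 1)) L"
    "L a = 1" "L b = 0"
proof -
  obtain t :: int where t: "0 \<le> t" "of_int t \<le> M" "0 < sin (pi * (of_int t * r))"
    "1 / sin (pi * (of_int t * r)) \<le> sqrt 2 * (if r \<le> 1 / (2 * M) then 1 / (2 * M * r) else 1)"
    using rounded_frequency[OF r(2,3) \<open>4 \<le> M\<close>] by blast
  define z where "z = b - a + n"
  define \<omega> where "\<omega> = (\<chi> i. of_int t * sgn (z $ i))"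
  have "of_int t * sgn u * u = of_int t * \<bar>u\<bar>" for u :: real
    by (simp add: sgn_if)
  then have "\<omega> \<bullet> z = of_int t * r"
    unfolding r(1) z_def[symmetric]
    by (simp only: \<omega>_def inner_vec_def l1norm_def sum_distrib_left inner_real_def vec_lambda_beta)
  moreover have "\<omega> \<bullet> n \<in> \<int>"
    using n unfolding inner_vec_def \<omega>_def int_vecs_def by (intro Ints_sum) (auto simp: sgn_if)
  moreover have "\<omega> \<bullet> b = of_int t * r + \<omega> \<bullet> a - \<omega> \<bullet> n"
    using calculation(1) by (simp add: z_def inner_add_right inner_diff_right)
  ultimately have "ee (\<omega> \<bullet> b) = ee (of_int t * r) * ee (\<omega> \<bullet> a)"
    by (simp add: ee_diff ee_add ee_int)
  define D where "D = ee (- (\<omega> \<bullet> a)) - ee (- (\<omega> \<bullet> b))"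
  have "cnj D = ee (\<omega> \<bullet> a) * (1 - ee (of_int t * r))"
    unfolding D_def complex_cnj_diff cnj_ee minus_minus \<open>ee (\<omega> \<bullet> b) = _\<close> by (simp add: algebra_simps)
  from arg_cong[OF this, of cmod] have "cmod D = 2 * \<bar>sin (pi * (of_int t * r))\<bar>"
    by (simp only: complex_mod_cnj norm_mult norm_ee mult_1 cmod_one_minus_ee)
  then have D: "cmod D = 2 * sin (pi * (of_int t * r))" "D \<noteq> 0" using t(3) by auto
  define L where "L y = (ee (- (\<omega> \<bullet> y)) - ee (- (\<omega> \<bullet> b))) / D" for y
  have "exp_sum_on (int_vecs \<inter> Qcube M) (sqrt 2 * (if r \<le> 1 / (2 * M) then 1 / (2 * M * r) else 1)) L"
  proof (rule exp_sum_on_indexed[where I=UNIV and w="\<lambda>p. if p then \<omega> else 0" and a="\<lambda>p. if p then 1 / D else - ee (- (\<omega> \<bullet> b)) / D"])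
    have "\<bar>\<omega> $ i\<bar> \<le> M" for i using t(1,2) \<open>4 \<le> M\<close> by (simp add: \<omega>_def abs_mult sgn_if)
    then have "\<omega> \<in> Qcube M" by (simp add: Qcube_def infnorm_le_cart_iff)
    moreover have "\<omega> \<in> int_vecs" by (auto simp: int_vecs_def \<omega>_def sgn_if)
    moreover have "0 \<in> int_vecs \<inter> Qcube M" using \<open>4 \<le> M\<close> by (auto simp: int_vecs_def Qcube_def infnorm_0)
    ultimately show "(if p then \<omega> else 0) \<in> int_vecs \<inter> Qcube M" for p by auto
    show "(\<Sum>p\<in>UNIV. cmod (if p then 1 / D else - ee (- (\<omega> \<bullet> b)) / D)) \<le> sqrt 2 * (if r \<le> 1 / (2 * M) then 1 / (2 * M * r) else 1)"
      using t(4) by (simp add: UNIV_bool norm_divide D(1))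
    show "L y = (\<Sum>p\<in>UNIV. (if p then 1 / D else - ee (- (\<omega> \<bullet> b)) / D) * ee (- ((if p then \<omega> else 0) \<bullet> y)))" for y
      by (simp add: L_def UNIV_bool diff_divide_distrib)
  qed simp
  moreover have "L a = 1" "L b = 0" using D(2) by (simp_all add: L_def D_def)
  ultimately show ?thesis using that by blast
qed

section \<open>Interpolation at clustered points\<close>

lemma greedy_colouring:
  assumes "finite X" and sym: "\<And>x y. R x y \<Longrightarrow> R y x"
    and deg: "\<And>x. x \<in> X \<Longrightarrow> card {y \<in> X. y \<noteq> x \<and> R x y} < n"
  shows "\<exists>c :: 'a \<Rightarrow> nat. (\<forall>x\<in>X. c x < n) \<and> (\<forall>x\<in>X. \<forall>y\<in>X. x \<noteq> y \<longrightarrow> R x y \<longrightarrow> c x \<noteq> c y)"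
  using assms(1) deg
proof (induction X rule: finite_induct)
  case (insert a X)
  have deg: "card {y \<in> X. y \<noteq> x \<and> R x y} < n" if "x \<in> X" for x
  proof -
    have "card {y \<in> X. y \<noteq> x \<and> R x y} \<le> card {y \<in> insert a X. y \<noteq> x \<and> R x y}"
      using insert(1) by (intro card_mono) auto
    then show ?thesis using insert.prems[of x] that by simp
  qed
  have "\<exists>c. (\<forall>x\<in>X. c x < n) \<and> (\<forall>x\<in>X. \<forall>y\<in>X. x \<noteq> y \<longrightarrow> R x y \<longrightarrow> c x \<noteq> c y)"
    by (rule insert.IH) (rule deg)
  then obtain c where c: "\<forall>x\<in>X. c x < n" "\<forall>x\<in>X. \<forall>y\<in>X. x \<noteq> y \<longrightarrow> R x y \<longrightarrow> c x \<noteq> c y"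
    by (elim exE conjE) (rule that)
  define U where "U = c ` {y \<in> X. R a y}"
  have "card U \<le> card {y \<in> X. R a y}" unfolding U_def using insert(1) by (intro card_image_le) auto
  also have "{y \<in> X. R a y} = {y \<in> insert a X. y \<noteq> a \<and> R a y}" using insert(2) by auto
  also have "card \<dots> < card {..<n}" using insert.prems[of a] by simp
  finally have "\<not> {..<n} \<subseteq> U"
    using card_mono[of U "{..<n}"] insert(1) by (auto simp: U_def)
  then obtain k where k: "k < n" "k \<notin> U" by auto
  have k': "c y \<noteq> k" if "y \<in> X" "R a y" for y using k(2) that unfolding U_def by blast
  show ?case
  proof (intro exI[of _ "c(a := k)"] conjI ballI impI)
    fix x assume "x \<in> insert a X"
    then show "(c(a := k)) x < n" using c(1) k(1) by auto
    fix y assume "y \<in> insert a X" "x \<noteq> y" "R x y"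
    then show "(c(a := k)) x \<noteq> (c(a := k)) y"
      using \<open>x \<in> insert a X\<close> c(2) k'[of y] k'[of x] sym[OF \<open>R x y\<close>] by (metis fun_upd_apply insertE)
  qed
qed auto

lemma Qcube_mono: "R \<le> S \<Longrightarrow> Qcube R \<subseteq> Qcube S"
  by (auto simp: Qcube_def)

text \<open>Frequency budget: \<open>\<nu>\<close> factors for the colour classes and at most \<open>\<nu> - 1\<close> for the neighbours of \<open>x k\<close>, each of
  radius \<open>M\<close>. The product in the bound may run over indices that are not neighbours, since its
  factors are at most \<open>1\<close>.\<close>

lemma cardinal_function_on_clusters:
  fixes x :: "'s::finite \<Rightarrow> real ^ 'd" and r :: "'s \<Rightarrow> 's \<Rightarrow> real"
  assumes \<Lambda>: "0 \<in> \<Lambda>" "\<And>a b. a \<in> \<Lambda> \<Longrightarrow> b \<in> \<Lambda> \<Longrightarrow> a + b \<in> \<Lambda>"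
    and near: "\<And>k. near k k" "\<And>j k. near j k \<Longrightarrow> near k j" "\<And>k. card {j. near k j} \<le> \<nu>"
    and "0 < M" "0 \<le> A"
    and interpolation: "\<And>J k. k \<in> J \<Longrightarrow> (\<And>i j. i \<in> J \<Longrightarrow> j \<in> J \<Longrightarrow> i \<noteq> j \<Longrightarrow> \<not> near i j) \<Longrightarrow>
       \<exists>f. exp_sum_on (\<Lambda> \<inter> Qcube M) A f \<and> (\<forall>j\<in>J. f (x j) = (if j = k then 1 else 0))"
    and factor: "\<And>j k. near k j \<Longrightarrow> j \<noteq> k \<Longrightarrow> 0 < r k j \<and> (\<exists>L. L (x k) = 1 \<and> L (x j) = 0 \<and>
       exp_sum_on (\<Lambda> \<inter> Qcube M) (sqrt 2 * (if r k j \<le> 1 / (2 * M) then 1 / (2 * M * r k j) else 1)) L)"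
  shows "\<exists>h. exp_sum_on (\<Lambda> \<inter> Qcube ((2 * real \<nu> - 1) * M))
       (A ^ \<nu> * sqrt 2 ^ (\<nu> - 1) / (\<Prod>j\<in>{j. 0 < r k j \<and> r k j \<le> 1 / (2 * M)}. 2 * M * r k j)) h \<and>
    (\<forall>j. h (x j) = (if j = k then 1 else 0))"
proof -
  define N where "N = {j. near k j \<and> j \<noteq> k}"
  have "card N < card {j. near k j}" unfolding N_def using near(1) by (intro psubset_card_mono) auto
  then have N: "card N \<le> \<nu> - 1" "1 \<le> \<nu>" using near(3)[of k] by auto
  have "card {j. j \<noteq> i \<and> near i j} < \<nu>" for i
  proof -
    have "card {j. j \<noteq> i \<and> near i j} < card {j. near i j}" using near(1) by (intro psubset_card_mono) auto
    then show ?thesis using near(3)[of i] by simp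
  qed
  then obtain c :: "'s \<Rightarrow> nat" where c: "\<And>j. c j < \<nu>" "\<And>i j. i \<noteq> j \<Longrightarrow> near i j \<Longrightarrow> c i \<noteq> c j"
    using greedy_colouring[of "UNIV :: 's set" near \<nu>] near(2) by auto
  \<comment> \<open>A colour class without the neighbours of \<open>k\<close> remains pairwise far when \<open>k\<close> is added.\<close>
  define J where "J a = insert k {j. c j = a \<and> \<not> near k j}" for a
  have "\<exists>f. exp_sum_on (\<Lambda> \<inter> Qcube M) A f \<and> (\<forall>j\<in>J a. f (x j) = (if j = k then 1 else 0))" for a
  proof (rule interpolation)
    show "\<not> near i j" if "i \<in> J a" "j \<in> J a" "i \<noteq> j" for i j
      using that c(2)[of i j] near(2)[of i j] by (auto simp: J_def)
  qed (simp add: J_def)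
  then obtain f where f: "\<And>a. exp_sum_on (\<Lambda> \<inter> Qcube M) A (f a)"
    "\<And>a j. j \<in> J a \<Longrightarrow> f a (x j) = (if j = k then 1 else 0)"
    by metis
  define b where "b j = (if r k j \<le> 1 / (2 * M) then 1 / (2 * M * r k j) else 1)" for j
  have "\<forall>j\<in>N. \<exists>L. L (x k) = 1 \<and> L (x j) = 0 \<and> exp_sum_on (\<Lambda> \<inter> Qcube M) (sqrt 2 * b j) L"
    using factor unfolding N_def b_def by blast
  then obtain L where L: "\<And>j. j \<in> N \<Longrightarrow> L j (x k) = 1 \<and> L j (x j) = 0 \<and> exp_sum_on (\<Lambda> \<inter> Qcube M) (sqrt 2 * b j) (L j)"
    by metis
  have rpos: "0 < r k j" if "j \<in> N" for j using factor that by (auto simp: N_def)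
  have b0: "0 \<le> b j" if "j \<in> N" for j using rpos[OF that] \<open>0 < M\<close> by (simp add: b_def)
  define p where "p = (\<Prod>j\<in>{j. 0 < r k j \<and> r k j \<le> 1 / (2 * M)}. 2 * M * r k j)"
  have p0: "0 < p" unfolding p_def using \<open>0 < M\<close> by (intro prod_pos) auto
  have "(\<Prod>j\<in>N. b j) * p \<le> 1"
  proof -
    define S where "S = {j\<in>N. r k j \<le> 1 / (2 * M)}"
    define T where "T = {j. 0 < r k j \<and> r k j \<le> 1 / (2 * M)}"
    have ST: "S \<subseteq> T" using rpos by (auto simp: S_def T_def)
    have b: "(\<Prod>j\<in>N. b j) = (\<Prod>j\<in>S. 1 / (2 * M * r k j))"
      by (simp add: b_def S_def prod.inter_filter[symmetric])
    have p: "p = (\<Prod>j\<in>T - S. 2 * M * r k j) * (\<Prod>j\<in>S. 2 * M * r k j)"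
      unfolding p_def T_def[symmetric] using ST by (intro prod.subset_diff) auto
    have "(\<Prod>j\<in>T - S. 2 * M * r k j) \<le> 1"
      using \<open>0 < M\<close> by (intro prod_le_1) (auto simp: T_def field_simps)
    moreover have "(\<Prod>j\<in>S. 1 / (2 * M * r k j)) * (\<Prod>j\<in>S. 2 * M * r k j) = 1"
      unfolding prod.distrib[symmetric] using rpos \<open>0 < M\<close>
      by (intro prod.neutral) (auto simp: S_def dest!: rpos)
    moreover have "(\<Prod>j\<in>N. b j) * p = (\<Prod>j\<in>T - S. 2 * M * r k j) * ((\<Prod>j\<in>S. 1 / (2 * M * r k j)) * (\<Prod>j\<in>S. 2 * M * r k j))"
      unfolding b p by (simp only: mult_ac)
    ultimately show ?thesis by simp
  qed
  then have prod_b: "(\<Prod>j\<in>N. b j) \<le> 1 / p" using p0 by (simp add: pos_le_divide_eq)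
  have e1: "exp_sum_on (\<Lambda> \<inter> Qcube (real \<nu> * M)) (A ^ \<nu>) (\<lambda>y. \<Prod>a<\<nu>. f a y)"
    using exp_sum_on_prod[OF finite_lessThan \<Lambda> f(1), of \<nu>] \<open>0 \<le> A\<close> by simp
  have e2: "exp_sum_on (\<Lambda> \<inter> Qcube (real (card N) * M)) (\<Prod>j\<in>N. sqrt 2 * b j) (\<lambda>y. \<Prod>j\<in>N. L j y)"
    using L b0 by (intro exp_sum_on_prod \<Lambda>) auto
  have card_N: "real (card N) \<le> real \<nu> - 1" using N by linarith
  define h where "h y = (\<Prod>a<\<nu>. f a y) * (\<Prod>j\<in>N. L j y)" for y
  have "exp_sum_on (\<Lambda> \<inter> Qcube ((2 * real \<nu> - 1) * M)) (A ^ \<nu> * (\<Prod>j\<in>N. sqrt 2 * b j)) h"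
    unfolding h_def
  proof (rule exp_sum_on_times[OF e1 e2])
    show "0 \<le> A ^ \<nu>" using \<open>0 \<le> A\<close> by simp
    fix u v assume uv: "u \<in> \<Lambda> \<inter> Qcube (real \<nu> * M)" "v \<in> \<Lambda> \<inter> Qcube (real (card N) * M)"
    have "real (card N) * M \<le> (real \<nu> - 1) * M" using card_N \<open>0 < M\<close> by (intro mult_right_mono) auto
    then have "real \<nu> * M + real (card N) * M \<le> (2 * real \<nu> - 1) * M" by (simp add: algebra_simps)
    then show "u + v \<in> \<Lambda> \<inter> Qcube ((2 * real \<nu> - 1) * M)"
      using uv \<Lambda>(2) Qcube_plus[of u "real \<nu> * M" v "real (card N) * M"] Qcube_mono by blast
  qed
  moreover have "A ^ \<nu> * (\<Prod>j\<in>N. sqrt 2 * b j) \<le> A ^ \<nu> * sqrt 2 ^ (\<nu> - 1) / p"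
  proof -
    have "(\<Prod>j\<in>N. sqrt 2 * b j) = sqrt 2 ^ card N * (\<Prod>j\<in>N. b j)" by (simp add: prod.distrib)
    also have "\<dots> \<le> sqrt 2 ^ (\<nu> - 1) * (1 / p)"
      using N(1) prod_b b0 by (intro mult_mono power_increasing prod_nonneg) auto
    finally have "A ^ \<nu> * (\<Prod>j\<in>N. sqrt 2 * b j) \<le> A ^ \<nu> * (sqrt 2 ^ (\<nu> - 1) * (1 / p))"
      using \<open>0 \<le> A\<close> by (intro mult_left_mono) auto
    then show ?thesis by simp
  qed
  ultimately have "exp_sum_on (\<Lambda> \<inter> Qcube ((2 * real \<nu> - 1) * M)) (A ^ \<nu> * sqrt 2 ^ (\<nu> - 1) / p) h"
    by (rule exp_sum_on_mono[OF _ order_refl])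
  moreover have "h (x j) = (if j = k then 1 else 0)" for j
  proof (cases "j = k")
    case True
    have "f a (x k) = 1" for a using f(2)[of k a] by (simp add: J_def)
    then show ?thesis using True L by (simp add: h_def)
  next
    case False
    have "h (x j) = 0"
    proof (cases "near k j")
      case True
      then have "j \<in> N" using False by (simp add: N_def)
      then show ?thesis using L[of j] by (auto simp: h_def intro!: prod_zero)
    next
      case far: False
      then have "f (c j) (x j) = 0" using f(2)[of j "c j"] False by (simp add: J_def)
      then show ?thesis using c(1)[of j] by (auto simp: h_def intro!: prod_zero)
    qed
    then show ?thesis using False by simp
  qed
  ultimately show ?thesis unfolding p_def by blast
qed

section \<open>From interpolation to lower bounds\<close>

lemma fourier_map_ee: "fourier_map x u \<omega> = (\<Sum>k\<in>UNIV. u $ k * ee (- (\<omega> \<bullet> x k)))"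
  by (simp add: fourier_map_def ee_def cis_conv_exp mult_ac)

lemma fourier_matrix_mult: "(\<Sum>k\<in>UNIV. fourier_matrix x \<omega> k * u $ k) = fourier_map x u \<omega>"
  by (simp add: fourier_matrix_def fourier_map_def mult.commute)

text \<open>Applying the coefficients of \<open>h\<close> to translates of the Fourier sum evaluates \<open>h\<close> at the nodes, which isolates one
  coefficient of \<open>u\<close> up to a unimodular factor.\<close>

lemma coefficient_bound_by_translates:
  fixes x :: "'s::finite \<Rightarrow> real ^ 'd"
  assumes "exp_sum_on \<Lambda> C h" and h: "\<And>j. h (x j) = (if j = k then 1 else 0)"
  obtains F \<alpha> where "finite F" "F \<subseteq> \<Lambda>" "(\<Sum>\<omega>\<in>F. cmod (\<alpha> \<omega>)) \<le> C"
    "\<And>u \<omega>\<^sub>0. (cmod (u $ k))\<^sup>2 \<le> C * (\<Sum>\<omega>\<in>F. cmod (\<alpha> \<omega>) * (cmod (fourier_map x u (\<omega>\<^sub>0 + \<omega>)))\<^sup>2)"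
proof -
  obtain F \<alpha> where F: "finite F" "F \<subseteq> \<Lambda>" "(\<Sum>\<omega>\<in>F. cmod (\<alpha> \<omega>)) \<le> C"
    "\<And>y. h y = (\<Sum>\<omega>\<in>F. \<alpha> \<omega> * ee (- (\<omega> \<bullet> y)))"
    using assms(1) unfolding exp_sum_on_def by blast
  have "(cmod (u $ k))\<^sup>2 \<le> C * (\<Sum>\<omega>\<in>F. cmod (\<alpha> \<omega>) * (cmod (fourier_map x u (\<omega>\<^sub>0 + \<omega>)))\<^sup>2)" for u \<omega>\<^sub>0
  proof -
    define P where "P \<omega> = fourier_map x u (\<omega>\<^sub>0 + \<omega>)" for \<omega>
    have "(\<Sum>\<omega>\<in>F. \<alpha> \<omega> * P \<omega>) = (\<Sum>\<omega>\<in>F. \<Sum>j\<in>UNIV. u $ j * ee (- (\<omega>\<^sub>0 \<bullet> x j)) * (\<alpha> \<omega> * ee (- (\<omega> \<bullet> x j))))"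
    proof (intro sum.cong refl)
      fix \<omega>
      have "ee (- ((\<omega>\<^sub>0 + \<omega>) \<bullet> x j)) = ee (- (\<omega>\<^sub>0 \<bullet> x j)) * ee (- (\<omega> \<bullet> x j))" for j
        by (simp add: inner_add_left flip: ee_add)
      then show "\<alpha> \<omega> * P \<omega> = (\<Sum>j\<in>UNIV. u $ j * ee (- (\<omega>\<^sub>0 \<bullet> x j)) * (\<alpha> \<omega> * ee (- (\<omega> \<bullet> x j))))"
        by (simp add: P_def fourier_map_ee sum_distrib_left mult_ac)
    qed
    also have "\<dots> = (\<Sum>j\<in>UNIV. u $ j * ee (- (\<omega>\<^sub>0 \<bullet> x j)) * h (x j))"
      unfolding F(4) sum_distrib_left by (rule sum.swap)
    also have "\<dots> = u $ k * ee (- (\<omega>\<^sub>0 \<bullet> x k))"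
      by (simp add: h if_distrib[of "\<lambda>z. _ * z"] cong: if_cong)
    finally have "cmod (u $ k) = cmod (\<Sum>\<omega>\<in>F. \<alpha> \<omega> * P \<omega>)" by (simp add: norm_mult)
    also have "\<dots> \<le> (\<Sum>\<omega>\<in>F. cmod (\<alpha> \<omega>) * cmod (P \<omega>))"
      by (rule order_trans[OF norm_sum]) (simp add: norm_mult)
    finally have "(cmod (u $ k))\<^sup>2 \<le> (\<Sum>\<omega>\<in>F. sqrt (cmod (\<alpha> \<omega>)) * (sqrt (cmod (\<alpha> \<omega>)) * cmod (P \<omega>)))\<^sup>2"
      by (intro power_mono) (simp_all add: mult.assoc[symmetric])
    also have "\<dots> \<le> (\<Sum>\<omega>\<in>F. (sqrt (cmod (\<alpha> \<omega>)))\<^sup>2) * (\<Sum>\<omega>\<in>F. (sqrt (cmod (\<alpha> \<omega>)) * cmod (P \<omega>))\<^sup>2)"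
      by (rule Cauchy_Schwarz_ineq_sum)
    also have "\<dots> = (\<Sum>\<omega>\<in>F. cmod (\<alpha> \<omega>)) * (\<Sum>\<omega>\<in>F. cmod (\<alpha> \<omega>) * (cmod (P \<omega>))\<^sup>2)"
      by (simp add: power_mult_distrib)
    also have "\<dots> \<le> C * (\<Sum>\<omega>\<in>F. cmod (\<alpha> \<omega>) * (cmod (P \<omega>))\<^sup>2)"
      by (intro mult_right_mono F(3) sum_nonneg) auto
    finally show ?thesis by (simp add: P_def)
  qed
  then show ?thesis using that F by blast
qed

lemma Qcube_translate_subset: "\<omega> \<in> Qcube R \<Longrightarrow> (\<lambda>\<omega>\<^sub>0. \<omega>\<^sub>0 + \<omega>) ` Qcube M \<subseteq> Qcube (R + M)"
  using Qcube_plus[of _ M \<omega> R] by (auto simp: add.commute)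

lemma finite_Qcube_int_vecs: "finite (Qcube R \<inter> int_vecs)"
  by (rule finite_subset[OF _ finite_bounded_int_vecs[of R]]) (auto simp: Qcube_def infnorm_le_cart_iff)

lemma int_vecs_add: "a \<in> int_vecs \<Longrightarrow> b \<in> int_vecs \<Longrightarrow> a + b \<in> int_vecs"
  by (auto simp: int_vecs_def)

lemma coefficient_bound_discrete:
  fixes x :: "'s::finite \<Rightarrow> real ^ 'd"
  assumes "exp_sum_on (int_vecs \<inter> Qcube R) C h" and "\<And>j. h (x j) = (if j = k then 1 else 0)"
  shows "(cmod (u $ k))\<^sup>2 * real (card ((Qcube M :: (real ^ 'd) set) \<inter> int_vecs)) \<le>
    C\<^sup>2 * (\<Sum>\<omega>\<in>Qcube (R + M) \<inter> int_vecs. (cmod (fourier_map x u \<omega>))\<^sup>2)"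
proof -
  obtain F \<alpha> where F: "finite F" "F \<subseteq> int_vecs \<inter> Qcube R" "(\<Sum>\<omega>\<in>F. cmod (\<alpha> \<omega>)) \<le> C"
    "\<And>u \<omega>\<^sub>0. (cmod (u $ k))\<^sup>2 \<le> C * (\<Sum>\<omega>\<in>F. cmod (\<alpha> \<omega>) * (cmod (fourier_map x u (\<omega>\<^sub>0 + \<omega>)))\<^sup>2)"
    using coefficient_bound_by_translates[OF assms] by blast
  define Q where "Q = (Qcube M :: (real ^ 'd) set) \<inter> int_vecs"
  define I where "I = (\<Sum>\<omega>\<in>Qcube (R + M) \<inter> int_vecs. (cmod (fourier_map x u \<omega>))\<^sup>2)"
  have C: "0 \<le> C" using F(3) sum_nonneg[of F "\<lambda>\<omega>. cmod (\<alpha> \<omega>)"] by simp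
  have "(cmod (u $ k))\<^sup>2 * real (card Q) = (\<Sum>\<omega>\<^sub>0\<in>Q. (cmod (u $ k))\<^sup>2)" by simp
  also have "\<dots> \<le> (\<Sum>\<omega>\<^sub>0\<in>Q. C * (\<Sum>\<omega>\<in>F. cmod (\<alpha> \<omega>) * (cmod (fourier_map x u (\<omega>\<^sub>0 + \<omega>)))\<^sup>2))"
    by (intro sum_mono F(4))
  also have "\<dots> = C * (\<Sum>\<omega>\<in>F. cmod (\<alpha> \<omega>) * (\<Sum>\<omega>\<^sub>0\<in>Q. (cmod (fourier_map x u (\<omega>\<^sub>0 + \<omega>)))\<^sup>2))"
    by (subst sum_distrib_left[symmetric], subst sum.swap) (simp add: sum_distrib_left)
  also have "\<dots> \<le> C * (\<Sum>\<omega>\<in>F. cmod (\<alpha> \<omega>) * I)"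
  proof (intro mult_left_mono sum_mono C)
    fix \<omega> assume "\<omega> \<in> F"
    have "(\<Sum>\<omega>\<^sub>0\<in>Q. (cmod (fourier_map x u (\<omega>\<^sub>0 + \<omega>)))\<^sup>2) = (\<Sum>\<omega>\<in>(\<lambda>\<omega>\<^sub>0. \<omega>\<^sub>0 + \<omega>) ` Q. (cmod (fourier_map x u \<omega>))\<^sup>2)"
      by (subst sum.reindex) auto
    also have "\<dots> \<le> I"
      unfolding I_def using \<open>\<omega> \<in> F\<close> F(2) Qcube_translate_subset[of \<omega> R M]
      by (intro sum_mono2 finite_Qcube_int_vecs) (auto simp: Q_def int_vecs_add)
    finally show "(\<Sum>\<omega>\<^sub>0\<in>Q. (cmod (fourier_map x u (\<omega>\<^sub>0 + \<omega>)))\<^sup>2) \<le> I" .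
  qed auto
  also have "\<dots> = C * ((\<Sum>\<omega>\<in>F. cmod (\<alpha> \<omega>)) * I)" by (simp add: sum_distrib_right)
  also have "\<dots> \<le> C * (C * I)"
    using C F(3) by (intro mult_left_mono mult_right_mono) (auto simp: I_def intro: sum_nonneg)
  finally show ?thesis by (simp add: Q_def I_def power2_eq_square mult.assoc)
qed

lemma Qcube_cbox: "Qcube R = cbox (\<chi> i. - R) (\<chi> i. R)"
  by (auto simp: Qcube_def infnorm_le_cart_iff mem_box_cart abs_le_iff minus_le_iff)

lemma continuous_fourier_map: "continuous_on S (\<lambda>\<omega>. fourier_map x u (\<omega> + c))"
  unfolding fourier_map_def by (intro continuous_intros)

lemma set_integrable_fourier_map:
  "set_integrable lborel (Qcube R) (\<lambda>\<omega>. (cmod (fourier_map x u (\<omega> + c)))\<^sup>2)"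
  unfolding set_integrable_def Qcube_cbox
  by (intro borel_integrable_compact continuous_intros continuous_fourier_map) auto

lemma coefficient_bound_continuous:
  fixes x :: "'s::finite \<Rightarrow> real ^ 'd"
  assumes "exp_sum_on (Qcube R) C h" and "\<And>j. h (x j) = (if j = k then 1 else 0)"
  shows "(cmod (u $ k))\<^sup>2 * measure lborel (Qcube M :: (real ^ 'd) set) \<le>
    C\<^sup>2 * (LINT \<omega>:Qcube (R + M)|lborel. (cmod (fourier_map x u \<omega>))\<^sup>2)"
proof -
  obtain F \<alpha> where F: "finite F" "F \<subseteq> Qcube R" "(\<Sum>\<omega>\<in>F. cmod (\<alpha> \<omega>)) \<le> C"
    "\<And>u \<omega>\<^sub>0. (cmod (u $ k))\<^sup>2 \<le> C * (\<Sum>\<omega>\<in>F. cmod (\<alpha> \<omega>) * (cmod (fourier_map x u (\<omega>\<^sub>0 + \<omega>)))\<^sup>2)"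
    using coefficient_bound_by_translates[OF assms] by blast
  define Q where "Q = (Qcube M :: (real ^ 'd) set)"
  define P where "P \<omega> = (cmod (fourier_map x u \<omega>))\<^sup>2" for \<omega>
  define I where "I = (LINT \<omega>:Qcube (R + M)|lborel. P \<omega>)"
  have C: "0 \<le> C" using F(3) sum_nonneg[of F "\<lambda>\<omega>. cmod (\<alpha> \<omega>)"] by simp
  have int: "set_integrable lborel (Qcube R) (\<lambda>\<omega>. P (\<omega> + c))" for R c
    unfolding P_def by (rule set_integrable_fourier_map)
  have meas [measurable]: "Qcube R \<in> sets borel" for R :: real unfolding Qcube_cbox by simp
  have I0: "0 \<le> I" unfolding I_def set_lebesgue_integral_def by (intro integral_nonneg_AE) (auto simp: P_def)
  have translate: "(LINT \<omega>\<^sub>0:Q|lborel. P (\<omega>\<^sub>0 + \<omega>)) \<le> I" if "\<omega> \<in> Qcube R" for \<omega>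
  proof -
    have "continuous_on UNIV P" unfolding P_def
      using continuous_fourier_map[of UNIV x u 0] by (intro continuous_intros) simp
    then have [measurable]: "P \<in> borel_measurable borel" by (rule borel_measurable_continuous_onI)
    have "(LINT \<omega>\<^sub>0:Q|lborel. P (\<omega>\<^sub>0 + \<omega>)) = (LINT \<omega>\<^sub>0|lborel. indicator Q (\<omega> + \<omega>\<^sub>0 - \<omega>) *\<^sub>R P (\<omega> + \<omega>\<^sub>0))"
      by (simp add: set_lebesgue_integral_def add.commute)
    also have "\<dots> = (LINT z|distr lborel borel ((+) \<omega>). indicator Q (z - \<omega>) *\<^sub>R P z)"
      by (subst integral_distr) (auto simp: Q_def)
    also have "\<dots> = (LINT z|lborel. indicator Q (z - \<omega>) *\<^sub>R P z)"
      by (simp add: lborel_distr_plus)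
    also have "\<dots> \<le> I"
      unfolding I_def set_lebesgue_integral_def
    proof (rule integral_mono_AE')
      show "integrable lborel (\<lambda>z. indicator (Qcube (R + M)) z *\<^sub>R P z)"
        using int[of "R + M" 0] by (simp add: set_integrable_def)
      have "z \<in> Qcube (R + M)" if "z - \<omega> \<in> Q" for z
        using Qcube_plus[OF \<open>\<omega> \<in> Qcube R\<close>, of "z - \<omega>" M] that by (simp add: Q_def)
      then show "AE z in lborel. indicator Q (z - \<omega>) *\<^sub>R P z \<le> indicator (Qcube (R + M)) z *\<^sub>R P z"
        by (intro AE_I2) (auto simp: indicator_def P_def)
      show "AE z in lborel. 0 \<le> indicator (Qcube (R + M)) z *\<^sub>R P z" by (auto simp: P_def)
    qed
    finally show ?thesis .
  qed
  have fin: "emeasure lborel Q < \<infinity>" unfolding Q_def Qcube_cbox by (simp add: emeasure_lborel_cbox_eq)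
  define g where "g \<omega> \<omega>\<^sub>0 = indicat_real Q \<omega>\<^sub>0 *\<^sub>R P (\<omega>\<^sub>0 + \<omega>)" for \<omega> \<omega>\<^sub>0
  have g: "integrable lborel (g \<omega>)" for \<omega>
    using int[of M \<omega>] unfolding set_integrable_def g_def [abs_def] Q_def .
  have g_sum: "indicat_real Q \<omega>\<^sub>0 *\<^sub>R (C * (\<Sum>\<omega>\<in>F. cmod (\<alpha> \<omega>) * P (\<omega>\<^sub>0 + \<omega>))) = C * (\<Sum>\<omega>\<in>F. cmod (\<alpha> \<omega>) * g \<omega> \<omega>\<^sub>0)" for \<omega>\<^sub>0
    by (simp add: g_def sum_distrib_left mult_ac)
  have "(cmod (u $ k))\<^sup>2 * measure lborel Q = (LINT \<omega>\<^sub>0:Q|lborel. (cmod (u $ k))\<^sup>2)"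
    using fin by (simp add: set_integral_const Q_def mult.commute)
  also have "\<dots> \<le> (LINT \<omega>\<^sub>0:Q|lborel. C * (\<Sum>\<omega>\<in>F. cmod (\<alpha> \<omega>) * P (\<omega>\<^sub>0 + \<omega>)))"
  proof (rule set_integral_mono)
    show "set_integrable lborel Q (\<lambda>\<omega>\<^sub>0. (cmod (u $ k))\<^sup>2)"
      unfolding set_integrable_def Q_def Qcube_cbox by (intro borel_integrable_compact continuous_intros) auto
    show "set_integrable lborel Q (\<lambda>\<omega>\<^sub>0. C * (\<Sum>\<omega>\<in>F. cmod (\<alpha> \<omega>) * P (\<omega>\<^sub>0 + \<omega>)))"
      unfolding set_integrable_def g_sum using g by simp
  qed (use F(4) in \<open>simp add: P_def\<close>)
  also have "\<dots> = C * (\<Sum>\<omega>\<in>F. cmod (\<alpha> \<omega>) * (LINT \<omega>\<^sub>0:Q|lborel. P (\<omega>\<^sub>0 + \<omega>)))"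
    unfolding set_lebesgue_integral_def g_sum g_def [symmetric] using g by simp
  also have "\<dots> \<le> C * (\<Sum>\<omega>\<in>F. cmod (\<alpha> \<omega>) * I)"
    using F(2) translate by (intro mult_left_mono sum_mono C) auto
  also have "\<dots> = C * ((\<Sum>\<omega>\<in>F. cmod (\<alpha> \<omega>)) * I)" by (simp add: sum_distrib_right)
  also have "\<dots> \<le> C * (C * I)"
    using C F(3) I0 by (intro mult_left_mono mult_right_mono)
  finally show ?thesis by (simp add: Q_def I_def P_def power2_eq_square mult.assoc)
qed

lemma unit_vector_lower_bound:
  fixes u :: "complex ^ 's::finite" and p :: "'s \<Rightarrow> real"
  assumes "norm u = 1" "0 < K" "\<And>k. 0 < p k" "0 \<le> V" "0 \<le> I"
    and coeff: "\<And>k. (cmod (u $ k))\<^sup>2 * V \<le> (K / p k)\<^sup>2 * I"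
  shows "sqrt (1 / real CARD('s)) * (1 / K) * sqrt V * (MIN k. p k) \<le> sqrt I"
proof -
  define q where "q = (MIN k. p k)"
  have q: "0 < q" "\<And>k. q \<le> p k" using assms(3) by (auto simp: q_def)
  have "V = (\<Sum>k\<in>UNIV. (cmod (u $ k))\<^sup>2) * V"
    using assms(1) by (simp add: norm_vec_def L2_set_def)
  also have "\<dots> \<le> (\<Sum>k\<in>(UNIV :: 's set). (K / q)\<^sup>2 * I)"
    unfolding sum_distrib_right
  proof (rule sum_mono)
    fix k
    have "(K / p k)\<^sup>2 * I \<le> (K / q)\<^sup>2 * I"
      using q assms(2,3,5) by (intro mult_right_mono power_mono divide_left_mono) (auto intro: less_imp_le)
    then show "(cmod (u $ k))\<^sup>2 * V \<le> (K / q)\<^sup>2 * I" using coeff[of k] by linarith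
  qed
  also have "\<dots> = real CARD('s) * (K / q)\<^sup>2 * I" by simp
  finally have "1 / real CARD('s) * (1 / K)\<^sup>2 * V * q\<^sup>2 \<le> I"
    using q(1) assms(2) by (simp add: field_simps)
  then have "sqrt (1 / real CARD('s) * (1 / K)\<^sup>2 * V * q\<^sup>2) \<le> sqrt I" by (rule real_sqrt_le_mono)
  moreover have "sqrt (1 / real CARD('s) * (1 / K)\<^sup>2 * V * q\<^sup>2) = sqrt (1 / real CARD('s)) * (1 / K) * sqrt V * q"
    using q(1) assms(2) by (simp only: real_sqrt_mult real_sqrt_abs) simp
  ultimately show ?thesis by (simp only: q_def)
qed

section \<open>Geometry of the two metrics\<close>

lemma card_near_le_local_sparsity:
  fixes x :: "'s::finite \<Rightarrow> real ^ 'd"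
  assumes "inj x"
  shows "card {j. N (x j - x k) \<le> \<tau>} \<le> local_sparsity N \<tau> (range x)"
proof -
  have "card {j. N (x j - x k) \<le> \<tau>} = card (x ` {j. N (x j - x k) \<le> \<tau>})"
    using assms by (intro card_image[symmetric]) (auto intro: inj_on_subset)
  also have "x ` {j. N (x j - x k) \<le> \<tau>} = nbhd N (x k) \<tau> (range x)" by (auto simp: nbhd_def)
  also have "card \<dots> \<le> local_sparsity N \<tau> (range x)"
    unfolding local_sparsity_def by (intro Max_ge) auto
  finally show ?thesis .
qed

lemma l1norm_le_infnorm: "l1norm (z :: real ^ 'd) \<le> real CARD('d) * infnorm z"
  unfolding l1norm_def using sum_bounded_above[of UNIV "\<lambda>i. \<bar>z $ i\<bar>" "infnorm z"]
  by (simp add: component_le_infnorm_cart)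

lemma l1norm_pos: "z \<noteq> 0 \<Longrightarrow> 0 < l1norm z"
  using component_le_l1norm[of z] by (force simp: vec_eq_iff intro: less_le_trans[of 0 "\<bar>z $ i\<bar>" for i])

lemma torus_infnorm_le: "n \<in> int_vecs \<Longrightarrow> torus_norm infnorm z \<le> infnorm (z + n)"
  using torus_norm_infnorm_attained[of z] by auto

lemma torus_l1norm_le: "n \<in> int_vecs \<Longrightarrow> torus_norm l1norm z \<le> l1norm (z + n)"
  using torus_norm_l1norm_attained[of z] by auto

lemma torus_infnorm_minus: "torus_norm infnorm (- z) = torus_norm infnorm z"
proof -
  have "torus_norm infnorm (- z) \<le> torus_norm infnorm z" for z :: "real ^ 'd"
  proof -
    obtain n where n: "n \<in> int_vecs" "torus_norm infnorm z = infnorm (z + n)"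
      using torus_norm_infnorm_attained[of z] by auto
    have "- n \<in> int_vecs" using n(1) by (auto simp: int_vecs_def)
    from torus_infnorm_le[OF this, of "- z"] show ?thesis
      using n(2) infnorm_neg[of "z + n"] by simp
  qed
  from this[of z] this[of "- z"] show ?thesis by simp
qed

lemma torus_infnorm_0: "torus_norm infnorm (0 :: real ^ 'd) \<le> 0"
  using torus_infnorm_le[of 0 0] by (simp add: int_vecs_def infnorm_0)

text \<open>Subtracting the nearest integer in every coordinate at once minimises all coordinates simultaneously, so the largest
  of them is far from every integer.\<close>

lemma torus_far_coordinate:
  fixes z :: "real ^ 'd"
  assumes "\<tau> < torus_norm infnorm z"
  shows "\<exists>i. \<forall>n::int. \<tau> \<le> \<bar>z $ i + of_int n\<bar>"
proof -
  define n where "n = (\<chi> i. - real_of_int (round (z $ i)))"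
  have "n \<in> int_vecs" by (simp add: int_vecs_def n_def)
  then have "\<not> infnorm (z + n) \<le> \<tau>" using torus_infnorm_le[of n z] assms by linarith
  then obtain i where i: "\<tau> < \<bar>z $ i - of_int (round (z $ i))\<bar>"
    unfolding infnorm_le_cart_iff by (auto simp: n_def not_le)
  have "\<tau> \<le> \<bar>z $ i + of_int m\<bar>" for m :: int
    using round_diff_minimal[of "z $ i" "- m"] i by simp
  then show ?thesis by blast
qed

text \<open>After halving, the coordinate has absolute value below \<open>1/2\<close>, so a nonzero integer moves it to at least \<open>1/2\<close>.\<close>

lemma euclidean_far_coordinate:
  fixes z :: "real ^ 'd"
  assumes "\<tau> < infnorm z" "\<tau> \<le> 1" and z: "\<And>i. \<bar>z $ i\<bar> < 1"
  shows "\<exists>i. \<forall>n::int. \<tau> / 2 \<le> \<bar>((1 / 2) *\<^sub>R z) $ i + of_int n\<bar>"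
proof -
  obtain i where i: "\<tau> < \<bar>z $ i\<bar>"
    using assms(1) infnorm_le_cart_iff[of z \<tau>] by (auto simp: not_le)
  have "\<tau> / 2 \<le> \<bar>z $ i / 2 + of_int n\<bar>" for n :: int
  proof (cases "n = 0")
    case False
    then have "1 \<le> \<bar>real_of_int n\<bar>" by simp
    then show ?thesis using z[of i] assms(2) by linarith
  qed (use i in simp)
  then show ?thesis by (intro exI[of _ i]) simp
qed

section \<open>Constants\<close>

text \<open>With \<open>y = 1 / (2\<beta>)\<close>, the bounds \<open>\<tau> M \<ge> \<beta> D\<close>, \<open>\<pi>\<^sup>2 \<ge> 9\<close> and \<open>\<beta> D \<ge> 1\<close> give
  \<open>3 D / (\<pi> \<tau> M)\<^sup>2 \<le> 2 y / 3\<close>, while \<open>exp y - 1 \<ge> y\<close>.\<close>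

lemma minorant_mass_bound:
  fixes \<beta> D M \<tau> :: real
  assumes \<beta>: "1 / (2 * ln 2) \<le> \<beta>" and "2 \<le> D" "0 < \<tau>" and M: "\<beta> * D / \<tau> \<le> M"
  shows "0 < 1 - 3 * D / (pi * \<tau> * M)\<^sup>2"
    and "2 - exp (1 / (2 * \<beta>)) \<le> 1 - 3 * D / (pi * \<tau> * M)\<^sup>2"
    and "1 / 2 \<le> \<beta>" "exp (1 / (2 * \<beta>)) \<le> 2"
proof -
  have ln2: "0 < ln (2::real)" "ln (2::real) \<le> 1" using ln_2_less_1 by auto
  have "1 / 2 \<le> 1 / (2 * ln (2::real))" using ln2 by (simp add: field_simps)
  then show \<beta>2: "1 / 2 \<le> \<beta>" using \<beta> by linarith
  then have "1 / (2 * \<beta>) \<le> ln 2" using \<beta> ln2 by (simp add: field_simps)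
  then show "exp (1 / (2 * \<beta>)) \<le> 2" by (metis exp_le_cancel_iff exp_ln zero_less_numeral)
  have tM: "\<beta> * D \<le> \<tau> * M" using M assms(3) by (simp add: field_simps)
  have bd: "0 < \<beta> * D" using \<beta>2 assms(2) by simp
  have "9 * (\<beta> * D)\<^sup>2 \<le> pi\<^sup>2 * (\<tau> * M)\<^sup>2"
  proof (rule mult_mono)
    have "3\<^sup>2 \<le> pi\<^sup>2" using pi_gt3 by (intro power_mono) auto
    then show "9 \<le> pi\<^sup>2" by simp
    show "(\<beta> * D)\<^sup>2 \<le> (\<tau> * M)\<^sup>2" using tM bd by (intro power_mono) auto
  qed auto
  then have "9 * (\<beta> * D)\<^sup>2 \<le> (pi * \<tau> * M)\<^sup>2" by (simp add: power_mult_distrib mult_ac)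
  moreover have "0 < 9 * (\<beta> * D)\<^sup>2" using bd by (metis mult_pos_pos zero_less_numeral zero_less_power)
  ultimately have "3 * D / (pi * \<tau> * M)\<^sup>2 \<le> 3 * D / (9 * (\<beta> * D)\<^sup>2)"
    using assms(2) by (intro frac_le) auto
  also have "\<dots> = (2 / (3 * \<beta> * D)) * (1 / (2 * \<beta>))"
    using \<beta>2 assms(2) by (simp add: field_simps power2_eq_square)
  also have "\<dots> \<le> (2 / 3) * (1 / (2 * \<beta>))"
  proof (rule mult_right_mono)
    have "1 / 2 * 2 \<le> \<beta> * D" using \<beta>2 assms(2) by (intro mult_mono) auto
    then show "2 / (3 * \<beta> * D) \<le> 2 / 3" using bd by (simp add: field_simps)
  qed (use \<beta>2 in auto)
  finally have *: "3 * D / (pi * \<tau> * M)\<^sup>2 \<le> (2 / 3) * (1 / (2 * \<beta>))" .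
  have y: "0 < 1 / (2 * \<beta>)" "1 / (2 * \<beta>) \<le> 1" using \<beta>2 by (auto simp: field_simps)
  show "0 < 1 - 3 * D / (pi * \<tau> * M)\<^sup>2" using * y by linarith
  show "2 - exp (1 / (2 * \<beta>)) \<le> 1 - 3 * D / (pi * \<tau> * M)\<^sup>2"
    using * y exp_ge_add_one_self[of "1 / (2 * \<beta>)"] by linarith
qed

lemma powr_half_nat:
  assumes "0 \<le> a" "1 \<le> n"
  shows "a powr (real n / 2) = sqrt a ^ n"
proof (cases "a = 0")
  case False
  then have "a powr (real n / 2) = (a powr (1 / 2)) powr real n" by (simp add: powr_powr)
  also have "\<dots> = sqrt a ^ n" using False assms(1) by (simp add: powr_half_sqrt powr_realpow)
  finally show ?thesis .
qed (use assms(2) in auto)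

text \<open>The \<open>\<nu> - 1\<close> factors \<open>\<surd>2\<close> of the near points account for the quotient between \<open>2 - e\<close> and
  \<open>1 - e / 2\<close> in all but one of the \<open>\<nu>\<close> powers; the last one is the \<open>2\<close> in \<open>2 / s\<close>.\<close>

lemma constant_comparison:
  fixes e \<rho> s V q :: real
  assumes "2 - e \<le> \<rho>" "0 < \<rho>" "e \<le> 2" "1 \<le> \<nu>" "0 \<le> s" "0 \<le> V" "0 \<le> q"
  shows "sqrt (2 / s) * (1 - 1 / 2 * e) powr (real \<nu> / 2) * V * q \<le>
    sqrt (1 / s) * (1 / ((1 / sqrt \<rho>) ^ \<nu> * sqrt 2 ^ (\<nu> - 1))) * V * q"
proof (intro mult_right_mono)
  have "(1 - 1 / 2 * e) powr (real \<nu> / 2) = sqrt (1 - 1 / 2 * e) ^ \<nu>"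
    using assms by (intro powr_half_nat) auto
  also have "\<dots> \<le> sqrt (\<rho> / 2) ^ \<nu>"
    using assms by (intro power_mono) auto
  also have "\<dots> = (sqrt \<rho>) ^ \<nu> / (sqrt 2 * sqrt 2 ^ (\<nu> - 1))"
    using assms(4) by (simp add: real_sqrt_divide power_divide flip: power_Suc)
  finally have "sqrt (2 / s) * (1 - 1 / 2 * e) powr (real \<nu> / 2) \<le>
      sqrt (2 / s) * ((sqrt \<rho>) ^ \<nu> / (sqrt 2 * sqrt 2 ^ (\<nu> - 1)))"
    using assms(5) by (intro mult_left_mono) auto
  also have "\<dots> = sqrt (1 / s) * (1 / ((1 / sqrt \<rho>) ^ \<nu> * sqrt 2 ^ (\<nu> - 1)))"
    using assms(2) by (simp add: real_sqrt_divide power_divide)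
  finally show "sqrt (2 / s) * (1 - 1 / 2 * e) powr (real \<nu> / 2) \<le>
      sqrt (1 / s) * (1 / ((1 / sqrt \<rho>) ^ \<nu> * sqrt 2 ^ (\<nu> - 1)))" .
qed (use assms in auto)

lemma frequency_budget_large:
  fixes \<beta> D M \<tau> :: real
  assumes "1 / 2 \<le> \<beta>" "2 \<le> D" "0 < \<tau>" "\<tau> \<le> 1 / (4 * D)" "\<beta> * D / \<tau> \<le> M"
  shows "4 \<le> M"
proof -
  have "4 * \<tau> \<le> 4 * (1 / (4 * D))" using assms(4) by simp
  also have "\<dots> \<le> 1 / 2 * 2" using assms(2) by (simp add: field_simps)
  also have "\<dots> \<le> \<beta> * D" using assms(1,2) by (intro mult_mono) auto
  finally have "4 \<le> \<beta> * D / \<tau>" using assms(3) by (simp add: field_simps)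
  then show ?thesis using assms(5) by linarith
qed

lemma unit_box_no_lattice_difference:
  fixes x :: "'s \<Rightarrow> real ^ 'd"
  assumes box: "\<And>k i. - 1 / 2 \<le> x k $ i \<and> x k $ i < 1 / 2" and "a \<in> int_vecs" "x j - x k + a = 0"
  shows "x j = x k"
proof -
  have "a $ i = 0" for i
  proof -
    have "a $ i = x k $ i - x j $ i" using assms(3) by (simp add: vec_eq_iff algebra_simps eq_diff_eq add_eq_0_iff)
    then have "\<bar>a $ i\<bar> < 1" using box[of j i] box[of k i] by linarith
    moreover have "a $ i \<in> \<int>" using assms(2) by (simp add: int_vecs_def)
    ultimately show ?thesis using Ints_nonzero_abs_less1 by blast
  qed
  then have "a = 0" by (simp add: vec_eq_iff)
  then show ?thesis using assms(3) by simp
qed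

section \<open>The lower bounds for both operators\<close>

text \<open>The part of the argument shared by both operators: \<open>near\<close> and \<open>r\<close> stand for closeness and \<open>\<ell>\<^sup>1\<close> distance in the
  respective metric, \<open>\<Lambda>\<close> for the admissible frequencies, \<open>V\<close> for the volume of the small cube and \<open>I\<close> for the
  squared norm of the Fourier sum on the large one.\<close>

lemma lower_bound_from_local_interpolation:
  fixes x :: "'s::finite \<Rightarrow> real ^ 'd" and u :: "complex ^ 's"
  assumes \<Lambda>: "0 \<in> \<Lambda>" "\<And>a b. a \<in> \<Lambda> \<Longrightarrow> b \<in> \<Lambda> \<Longrightarrow> a + b \<in> \<Lambda>"
    and near: "\<And>k. near k k" "\<And>j k. near j k \<Longrightarrow> near k j" "\<And>k. card {j. near k j} \<le> n"
    and const: "0 < M" "0 < \<rho>" "2 - e \<le> \<rho>" "e \<le> 2"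
    and interpolation: "\<And>J k. k \<in> J \<Longrightarrow> (\<And>i j. i \<in> J \<Longrightarrow> j \<in> J \<Longrightarrow> i \<noteq> j \<Longrightarrow> \<not> near i j) \<Longrightarrow>
       \<exists>f. exp_sum_on (\<Lambda> \<inter> Qcube M) (1 / sqrt \<rho>) f \<and> (\<forall>j\<in>J. f (x j) = (if j = k then 1 else 0))"
    and factor: "\<And>j k. near k j \<Longrightarrow> j \<noteq> k \<Longrightarrow> 0 < r k j \<and> (\<exists>L. L (x k) = 1 \<and> L (x j) = 0 \<and>
       exp_sum_on (\<Lambda> \<inter> Qcube M) (sqrt 2 * (if r k j \<le> 1 / (2 * M) then 1 / (2 * M * r k j) else 1)) L)"
    and u: "norm u = 1" and VI: "0 \<le> V" "0 \<le> I"
    and coeff: "\<And>C h k. exp_sum_on (\<Lambda> \<inter> Qcube ((2 * real n - 1) * M)) C h \<Longrightarrow>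
       (\<And>j. h (x j) = (if j = k then 1 else 0)) \<Longrightarrow> (cmod (u $ k))\<^sup>2 * V \<le> C\<^sup>2 * I"
  shows "sqrt (2 / real CARD('s)) * (1 - 1 / 2 * e) powr (real n / 2) * sqrt V *
    (MIN k. \<Prod>j\<in>{j. 0 < r k j \<and> r k j \<le> 1 / (2 * M)}. 2 * M * r k j) \<le> sqrt I"
proof -
  define p where "p k = (\<Prod>j\<in>{j. 0 < r k j \<and> r k j \<le> 1 / (2 * M)}. 2 * M * r k j)" for k
  define K where "K = (1 / sqrt \<rho>) ^ n * sqrt 2 ^ (n - 1)"
  have p0: "0 < p k" for k unfolding p_def using const(1) by (intro prod_pos) auto
  have K0: "0 < K" using const(2) by (simp add: K_def)
  have "0 < card {j. near k j}" for k using near(1) by (auto simp: card_gt_0_iff)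
  from this[of undefined] have n: "1 \<le> n" using near(3)[of undefined] by linarith
  have "(cmod (u $ k))\<^sup>2 * V \<le> (K / p k)\<^sup>2 * I" for k
  proof -
    have A: "0 \<le> 1 / sqrt \<rho>" using const(2) by simp
    have "\<exists>h. exp_sum_on (\<Lambda> \<inter> Qcube ((2 * real n - 1) * M)) (K / p k) h \<and> (\<forall>j. h (x j) = (if j = k then 1 else 0))"
      unfolding K_def p_def
      by (rule cardinal_function_on_clusters[where near=near, OF \<Lambda> near const(1) A interpolation factor])
    then obtain h where h: "exp_sum_on (\<Lambda> \<inter> Qcube ((2 * real n - 1) * M)) (K / p k) h"
      "\<forall>j. h (x j) = (if j = k then 1 else 0)"
      by (elim exE conjE) (rule that)
    show ?thesis using h(2) by (intro coeff[OF h(1)]) blast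
  qed
  from unit_vector_lower_bound[OF u K0 p0 VI this]
  have "sqrt (1 / real CARD('s)) * (1 / K) * sqrt V * (MIN k. p k) \<le> sqrt I" .
  moreover have "sqrt (2 / real CARD('s)) * (1 - 1 / 2 * e) powr (real n / 2) * sqrt V * (MIN k. p k) \<le>
     sqrt (1 / real CARD('s)) * (1 / K) * sqrt V * (MIN k. p k)"
    unfolding K_def using VI(1)
    by (intro constant_comparison[OF const(3,2,4) n]) (auto intro!: less_imp_le[OF p0] simp: Min_ge_iff)
  ultimately show ?thesis by (simp add: p_def)
qed

lemma local_sparsity_pos:
  fixes x :: "'s::finite \<Rightarrow> real ^ 'd"
  assumes "inj x" "N 0 \<le> \<tau>"
  shows "1 \<le> local_sparsity N \<tau> (range x)"
proof -
  have "0 < card {j. N (x j - x k) \<le> \<tau>}" for k using assms(2) by (auto simp: card_gt_0_iff intro!: exI[of _ k])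
  from this[of undefined] show ?thesis
    using card_near_le_local_sparsity[OF assms(1), of N undefined \<tau>] by linarith
qed

lemma parameter_bounds:
  fixes \<beta> D \<nu> \<tau> m :: real
  defines "M \<equiv> m / (2 * \<nu>)"
  defines "\<rho> \<equiv> 1 - 3 * D / (pi * \<tau> * M)\<^sup>2"
  assumes "1 / (2 * ln 2) \<le> \<beta>" "2 \<le> D" "0 < \<tau>" "\<tau> \<le> 1 / (4 * D)" "1 \<le> \<nu>" "2 * \<beta> * D * \<nu> / \<tau> \<le> m"
  shows "0 < \<rho>" "2 - exp (1 / (2 * \<beta>)) \<le> \<rho>" "exp (1 / (2 * \<beta>)) \<le> 2" "4 \<le> M" "\<tau> \<le> 1"
    "(2 * \<nu> - 1) * M + M = m" "m / \<nu> = 2 * M" "\<nu> / m = 1 / (2 * M)"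
proof -
  have scale: "\<beta> * D / \<tau> \<le> M" using assms(7,8) by (simp add: M_def field_simps)
  note num = minorant_mass_bound[OF assms(3-5) scale, folded \<rho>_def]
  then show "0 < \<rho>" "2 - exp (1 / (2 * \<beta>)) \<le> \<rho>" "exp (1 / (2 * \<beta>)) \<le> 2" by auto
  show M4: "4 \<le> M" by (rule frequency_budget_large[OF num(3) assms(4-6) scale])
  have "1 / (4 * D) \<le> 1" using assms(4) by (simp add: field_simps)
  then show "\<tau> \<le> 1" using assms(6) by linarith
  show "(2 * \<nu> - 1) * M + M = m" "m / \<nu> = 2 * M" "\<nu> / m = 1 / (2 * M)"
    using assms(7) M4 by (auto simp: M_def field_simps)
qed

lemma mult_quarter_bound: "2 \<le> D \<Longrightarrow> \<tau> \<le> 1 / (4 * D) \<Longrightarrow> D * \<tau> \<le> (1 / 4 :: real)"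
  by (simp add: field_simps)

lemma sigma_min_F_lower_bound:
  fixes x :: "'s::finite \<Rightarrow> real ^ 'd" and \<beta> \<tau> m :: real
  defines "\<nu> \<equiv> real (local_sparsity infnorm \<tau> (range x))"
  assumes d: "CARD('d) \<ge> 2" and \<beta>: "\<beta> \<ge> 1 / (2 * ln 2)" and "inj x"
    and box: "\<And>k i. - 1 / 2 \<le> x k $ i \<and> x k $ i < 1 / 2"
    and \<tau>: "0 < \<tau>" "\<tau> \<le> 1 / (4 * real CARD('d))"
    and m: "2 * \<beta> * real CARD('d) * \<nu> / \<tau> \<le> m"
  shows "sqrt (2 / real CARD('s)) * (1 - 1 / 2 * exp (1 / (2 * \<beta>))) powr (\<nu> / 2) *
           sqrt (measure lborel (Qcube (m / (2 * \<nu>)) :: (real ^ 'd) set)) *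
           (MIN k. \<Prod>j\<in>{j. 0 < l1norm (x j - x k) \<and> l1norm (x j - x k) \<le> \<nu> / m}.
              m / \<nu> * l1norm (x j - x k)) \<le> sigma_min_F (Qcube m) x"
proof -
  define n where "n = local_sparsity infnorm \<tau> (range x)"
  define M where "M = m / (2 * \<nu>)"
  define \<rho> where "\<rho> = 1 - 3 * real CARD('d) / (pi * \<tau> * M)\<^sup>2"
  define near where "near k j \<longleftrightarrow> infnorm (x j - x k) \<le> \<tau>" for k j
  define r where "r k j = l1norm (x j - x k)" for k j
  have zero: "infnorm (0 :: real ^ 'd) \<le> \<tau>"
    using \<tau>(1) by (simp add: infnorm_0)
  have \<nu>: "\<nu> = real n" by (simp add: \<nu>_def n_def)
  have "1 \<le> \<nu>" using local_sparsity_pos[of x _ \<tau>] \<open>inj x\<close> zero by (simp add: \<nu>_def)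
  have D: "2 \<le> real CARD('d)" using d by simp
  note par = parameter_bounds[OF \<beta> D \<tau> \<open>1 \<le> \<nu>\<close> m, folded M_def, folded \<rho>_def]
  have diff: "\<bar>(x j - x k) $ i\<bar> < 1" for j k i using box[of j i] box[of k i] by auto
  have interpolation: "\<exists>f. exp_sum_on (UNIV \<inter> Qcube M) (1 / sqrt \<rho>) f \<and> (\<forall>j\<in>J. f (x j) = (if j = k then 1 else 0))"
    if kJ: "k \<in> J" and J: "\<And>i j. i \<in> J \<Longrightarrow> j \<in> J \<Longrightarrow> i \<noteq> j \<Longrightarrow> \<not> near i j" for J k
  proof -
    \<comment> \<open>Halving the points halves \<open>\<tau>\<close> and doubles the admissible frequencies, so that the constant is unchanged.\<close>
    have \<rho>': "1 - 3 * real CARD('d) / (pi * (\<tau> / 2) * (2 * M))\<^sup>2 = \<rho>" by (simp add: \<rho>_def mult.assoc)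
    have half: "0 < \<tau> / 2" "\<tau> / 2 \<le> 1" "0 < 2 * M" using \<tau>(1) par(4,5) by auto
    have far: "\<exists>i. \<forall>n::int. \<tau> / 2 \<le> \<bar>((1 / 2) *\<^sub>R x a - (1 / 2) *\<^sub>R x b) $ i + of_int n\<bar>"
      if "a \<in> J" "b \<in> J" "a \<noteq> b" for a b
      using euclidean_far_coordinate[of \<tau> "x a - x b", OF _ par(5) diff] J[OF that(2,1)] that(3)
      unfolding scaleR_diff_right near_def by (simp add: not_le)
    have "\<exists>g. exp_sum_on (int_vecs \<inter> Qcube (2 * M)) (1 / sqrt \<rho>) g \<and>
        (\<forall>j\<in>J. g ((1 / 2) *\<^sub>R x j) = (if j = k then 1 else 0))"
      by (rule separated_interpolation[where y="\<lambda>j. (1 / 2) *\<^sub>R x j", OF half kJ far par(1)[folded \<rho>'], unfolded \<rho>'])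
    then obtain g where g: "exp_sum_on (int_vecs \<inter> Qcube (2 * M)) (1 / sqrt \<rho>) g"
      "\<forall>j\<in>J. g ((1 / 2) *\<^sub>R x j) = (if j = k then 1 else 0)"
      by (elim exE conjE) (rule that)
    have "exp_sum_on (UNIV \<inter> Qcube M) (1 / sqrt \<rho>) (\<lambda>y. g ((1 / 2) *\<^sub>R y))"
      by (rule exp_sum_on_scale[OF g(1)]) (auto simp: Qcube_def infnorm_le_cart_iff mult.commute)
    then show ?thesis using g(2) by blast
  qed
  have factor: "0 < r k j \<and> (\<exists>L. L (x k) = 1 \<and> L (x j) = 0 \<and>
       exp_sum_on (UNIV \<inter> Qcube M) (sqrt 2 * (if r k j \<le> 1 / (2 * M) then 1 / (2 * M * r k j) else 1)) L)"
    if "near k j" "j \<noteq> k" for j k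
  proof -
    have "x j \<noteq> x k" using \<open>inj x\<close> that(2) by (auto dest: injD)
    then have pos: "0 < r k j" unfolding r_def by (intro l1norm_pos) simp
    have "r k j \<le> real CARD('d) * infnorm (x j - x k)" unfolding r_def by (rule l1norm_le_infnorm)
    also have "\<dots> \<le> real CARD('d) * \<tau>" using that(1) by (intro mult_left_mono) (auto simp: near_def)
    also have "\<dots> \<le> 1 / 4" by (rule mult_quarter_bound[OF D \<tau>(2)])
    finally obtain L where L: "exp_sum_on (int_vecs \<inter> Qcube M) (sqrt 2 * (if r k j \<le> 1 / (2 * M) then 1 / (2 * M * r k j) else 1)) L"
      "L (x k) = 1" "L (x j) = 0"
      using lagrange_factor[of 0 "r k j" "x j" "x k" M] pos par(4) by (auto simp: r_def int_vecs_def)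
    have "exp_sum_on (UNIV \<inter> Qcube M) (sqrt 2 * (if r k j \<le> 1 / (2 * M) then 1 / (2 * M * r k j) else 1)) L"
      by (rule exp_sum_on_mono[OF L(1)]) auto
    then show ?thesis using pos L by blast
  qed
  obtain u where u: "norm u = 1" "sigma_min_F (Qcube m) x = L2norm_on (Qcube m) (fourier_map x u)"
    using sigma_min_F_attained[of "Qcube m" x] by (auto simp: Qcube_cbox)
  define I where "I = (LINT \<omega>:Qcube m|lborel. (cmod (fourier_map x u \<omega>))\<^sup>2)"
  have I: "0 \<le> I" "sigma_min_F (Qcube m) x = sqrt I"
    unfolding u(2) I_def L2norm_on_def set_lebesgue_integral_def by (auto intro!: integral_nonneg_AE)
  have "sqrt (2 / real CARD('s)) * (1 - 1 / 2 * exp (1 / (2 * \<beta>))) powr (real n / 2) *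
     sqrt (measure lborel (Qcube M :: (real ^ 'd) set)) *
     (MIN k. \<Prod>j\<in>{j. 0 < r k j \<and> r k j \<le> 1 / (2 * M)}. 2 * M * r k j) \<le> sqrt I"
  proof (rule lower_bound_from_local_interpolation[where \<Lambda>=UNIV and near=near and \<rho>=\<rho> and x=x, OF _ _ _ _ _ _ par(1-3) interpolation factor u(1) measure_nonneg I(1)])
    show "near k k" for k using zero by (simp add: near_def)
    show "near k j" if "near j k" for j k
      using that infnorm_neg[of "x j - x k"] by (simp add: near_def)
    show "card {j. near k j} \<le> n" for k
      unfolding near_def n_def by (rule card_near_le_local_sparsity) fact
    show "(cmod (u $ k))\<^sup>2 * measure lborel (Qcube M :: (real ^ 'd) set) \<le> C\<^sup>2 * I"
      if "exp_sum_on (UNIV \<inter> Qcube ((2 * real n - 1) * M)) C h" "\<And>j. h (x j) = (if j = k then 1 else 0)" for C h k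
      using coefficient_bound_continuous[OF that(1)[unfolded Int_UNIV_left] that(2), where u=u and M=M] par(6)
      by (simp add: I_def \<nu>)
  qed (use par(4) in \<open>auto\<close>)
  then show ?thesis
    unfolding I(2) par(7,8) M_def[symmetric] \<nu>[symmetric] r_def .
qed

lemma sigma_min_Phi_lower_bound:
  fixes x :: "'s::finite \<Rightarrow> real ^ 'd" and \<beta> \<tau> m :: real
  defines "\<nu> \<equiv> real (local_sparsity (torus_norm infnorm) \<tau> (range x))"
  assumes d: "CARD('d) \<ge> 2" and \<beta>: "\<beta> \<ge> 1 / (2 * ln 2)" and "inj x"
    and box: "\<And>k i. - 1 / 2 \<le> x k $ i \<and> x k $ i < 1 / 2"
    and \<tau>: "0 < \<tau>" "\<tau> \<le> 1 / (4 * real CARD('d))"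
    and m: "2 * \<beta> * real CARD('d) * \<nu> / \<tau> \<le> m"
  shows "sqrt (2 / real CARD('s)) * (1 - 1 / 2 * exp (1 / (2 * \<beta>))) powr (\<nu> / 2) *
           sqrt (real (card ((Qcube (m / (2 * \<nu>)) :: (real ^ 'd) set) \<inter> int_vecs))) *
           (MIN k. \<Prod>j\<in>{j. 0 < torus_norm l1norm (x j - x k) \<and> torus_norm l1norm (x j - x k) \<le> \<nu> / m}.
              m / \<nu> * torus_norm l1norm (x j - x k)) \<le> sigma_min_Phi (Qcube m) x"
proof -
  define n where "n = local_sparsity (torus_norm infnorm) \<tau> (range x)"
  define M where "M = m / (2 * \<nu>)"
  define \<rho> where "\<rho> = 1 - 3 * real CARD('d) / (pi * \<tau> * M)\<^sup>2"
  define near where "near k j \<longleftrightarrow> torus_norm infnorm (x j - x k) \<le> \<tau>" for k j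
  define r where "r k j = torus_norm l1norm (x j - x k)" for k j
  have zero: "torus_norm infnorm (0 :: real ^ 'd) \<le> \<tau>"
    using \<tau>(1) torus_infnorm_0[where 'd='d] by (simp)
  have \<nu>: "\<nu> = real n" by (simp add: \<nu>_def n_def)
  have "1 \<le> \<nu>" using local_sparsity_pos[of x _ \<tau>] \<open>inj x\<close> zero by (simp add: \<nu>_def)
  have D: "2 \<le> real CARD('d)" using d by simp
  note par = parameter_bounds[OF \<beta> D \<tau> \<open>1 \<le> \<nu>\<close> m, folded M_def, folded \<rho>_def]
  have M0: "0 < M" using par(4) by simp
  have interpolation: "\<exists>f. exp_sum_on (int_vecs \<inter> Qcube M) (1 / sqrt \<rho>) f \<and> (\<forall>j\<in>J. f (x j) = (if j = k then 1 else 0))"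
    if kJ: "k \<in> J" and J: "\<And>i j. i \<in> J \<Longrightarrow> j \<in> J \<Longrightarrow> i \<noteq> j \<Longrightarrow> \<not> near i j" for J k
  proof -
    have far: "\<exists>i. \<forall>n::int. \<tau> \<le> \<bar>(x a - x b) $ i + of_int n\<bar>" if "a \<in> J" "b \<in> J" "a \<noteq> b" for a b
      using torus_far_coordinate[of \<tau> "x a - x b"] J[OF that(2,1)] that(3) by (simp add: near_def not_le)
    show ?thesis
      by (rule separated_interpolation[where y=x, OF \<tau>(1) par(5) M0 kJ far par(1)[unfolded \<rho>_def], folded \<rho>_def])
  qed
  have factor: "0 < r k j \<and> (\<exists>L. L (x k) = 1 \<and> L (x j) = 0 \<and>
       exp_sum_on (int_vecs \<inter> Qcube M) (sqrt 2 * (if r k j \<le> 1 / (2 * M) then 1 / (2 * M * r k j) else 1)) L)"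
    if "near k j" "j \<noteq> k" for j k
  proof -
    obtain a where a: "a \<in> int_vecs" "r k j = l1norm (x j - x k + a)"
      using torus_norm_l1norm_attained[of "x j - x k"] by (auto simp: r_def)
    obtain b where b: "b \<in> int_vecs" "torus_norm infnorm (x j - x k) = infnorm (x j - x k + b)"
      using torus_norm_infnorm_attained[of "x j - x k"] by auto
    have "x j \<noteq> x k" using \<open>inj x\<close> that(2) by (auto dest: injD)
    then have "x j - x k + a \<noteq> 0" using unit_box_no_lattice_difference[where x=x, OF box a(1), of j k] by blast
    then have pos: "0 < r k j" unfolding a(2) by (rule l1norm_pos)
    have "r k j \<le> l1norm (x j - x k + b)" unfolding r_def by (rule torus_l1norm_le[OF b(1)])
    also have "\<dots> \<le> real CARD('d) * infnorm (x j - x k + b)" by (rule l1norm_le_infnorm)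
    also have "\<dots> \<le> real CARD('d) * \<tau>" using that(1) b(2) by (intro mult_left_mono) (auto simp: near_def)
    also have "\<dots> \<le> 1 / 4" by (rule mult_quarter_bound[OF D \<tau>(2)])
    finally show ?thesis using lagrange_factor[OF a pos _ par(4)] pos by blast
  qed
  obtain u where u: "norm u = 1"
    "sigma_min_Phi (Qcube m) x = L2_set (\<lambda>\<omega>. cmod (\<Sum>k\<in>UNIV. fourier_matrix x \<omega> k * u $ k)) (Qcube m \<inter> int_vecs)"
    using sigma_min_Phi_attained[of "Qcube m" x] by auto
  define I where "I = (\<Sum>\<omega>\<in>Qcube m \<inter> int_vecs. (cmod (fourier_map x u \<omega>))\<^sup>2)"
  have I: "0 \<le> I" "sigma_min_Phi (Qcube m) x = sqrt I"
    unfolding u(2) I_def L2_set_def fourier_matrix_mult by (auto intro: sum_nonneg)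
  have "sqrt (2 / real CARD('s)) * (1 - 1 / 2 * exp (1 / (2 * \<beta>))) powr (real n / 2) *
     sqrt (real (card ((Qcube M :: (real ^ 'd) set) \<inter> int_vecs))) *
     (MIN k. \<Prod>j\<in>{j. 0 < r k j \<and> r k j \<le> 1 / (2 * M)}. 2 * M * r k j) \<le> sqrt I"
  proof (rule lower_bound_from_local_interpolation[where \<Lambda>=int_vecs and near=near and \<rho>=\<rho> and x=x, OF _ _ _ _ _ _ par(1-3) interpolation factor u(1) of_nat_0_le_iff I(1)])
    show "near k k" for k using zero by (simp add: near_def)
    show "near k j" if "near j k" for j k
      using that torus_infnorm_minus[of "x j - x k"] by (simp add: near_def)
    show "card {j. near k j} \<le> n" for k
      unfolding near_def n_def by (rule card_near_le_local_sparsity) fact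
    show "(cmod (u $ k))\<^sup>2 * real (card ((Qcube M :: (real ^ 'd) set) \<inter> int_vecs)) \<le> C\<^sup>2 * I"
      if "exp_sum_on (int_vecs \<inter> Qcube ((2 * real n - 1) * M)) C h" "\<And>j. h (x j) = (if j = k then 1 else 0)" for C h k
      using coefficient_bound_discrete[OF that(1) that(2), where u=u and M=M] par(6)
      by (simp add: I_def \<nu>)
  qed (use par(4) int_vecs_add in \<open>auto simp: int_vecs_def\<close>)
  then show ?thesis
    unfolding I(2) par(7,8) M_def[symmetric] \<nu>[symmetric] r_def .
qed

theorem theorem3p10:
  fixes x :: "'s::finite \<Rightarrow> real ^ 'd" and \<beta> \<tau> m :: real
  assumes "CARD('d) \<ge> 2"
    and "\<beta> \<ge> 1 / (2 * ln 2)"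
    and "inj x"
    and "\<And>k i. - 1 / 2 \<le> x k $ i \<and> x k $ i < 1 / 2"
    and "m \<ge> 4 * real CARD('s)"
    and "0 < \<tau>" and "\<tau> \<le> 1 / (4 * real CARD('d))"
  shows
    "(let \<nu> = real (local_sparsity infnorm \<tau> (range x))
      in 2 * \<beta> * real CARD('d) * \<nu> / \<tau> \<le> m \<longrightarrow>
         sigma_min_F (Qcube m) x \<ge>
           sqrt (2 / real CARD('s)) * (1 - 1 / 2 * exp (1 / (2 * \<beta>))) powr (\<nu> / 2) *
           sqrt (measure lborel (Qcube (m / (2 * \<nu>)) :: (real ^ 'd) set)) *
           (MIN k. \<Prod>j\<in>{j. 0 < l1norm (x j - x k) \<and> l1norm (x j - x k) \<le> \<nu> / m}.
              m / \<nu> * l1norm (x j - x k))) \<and>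
     (let \<nu> = real (local_sparsity (torus_norm infnorm) \<tau> (range x))
      in 2 * \<beta> * real CARD('d) * \<nu> / \<tau> \<le> m \<longrightarrow>
         sigma_min_Phi (Qcube m) x \<ge>
           sqrt (2 / real CARD('s)) * (1 - 1 / 2 * exp (1 / (2 * \<beta>))) powr (\<nu> / 2) *
           sqrt (real (card ((Qcube (m / (2 * \<nu>)) :: (real ^ 'd) set) \<inter> int_vecs))) *
           (MIN k. \<Prod>j\<in>{j. 0 < torus_norm l1norm (x j - x k) \<and> torus_norm l1norm (x j - x k) \<le> \<nu> / m}.
              m / \<nu> * torus_norm l1norm (x j - x k)))"
  unfolding Let_def
  by (intro conjI impI)
    (rule sigma_min_F_lower_bound[OF assms(1-4,6,7)] sigma_min_Phi_lower_bound[OF assms(1-4,6,7)], assumption)+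

end
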